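(* Let $q\in L_1(0,1)$ and consider the eigenvalue transmission problem for $(\lambda,u_1,u_2)$: $$u_1''+[\lambda-q(x)]u_1=0,\ x\in(0,\tfrac12),\qquad u_2''+[\lambda-q(x)]u_2=0,\ x\in(\tfrac12,1),$$ $$u_1(0)=u_2(1)=0,\quad u_1'(0)=1,\quad u_2(\tfrac12)-u_1(\tfrac12)=0,\quad u_2'(\tfrac12)-u_1'(\tfrac12)=1.$$ Let $(\lambda_n^{(j)},u_n^{(j)})_{j\ge0}$ be the FD-method sequence described in the context, started from the trial eigenpair $(\lambda_n^{(0)},u_n^{(0)})$, and let $\overset{m}{\lambda}_n=\sum_{j=0}^m\lambda_n^{(j)}$, $\overset{m}{u}_{n}=\sum_{j=0}^m u_n^{(j)}$ (componentwise on the two subintervals). Put $$R=\frac{1}{\frac{11}{3}\|q\|_{0,1}\left(1+\frac{16}{3}+2\sqrt{\frac{88}{9}}\right)}.$$ (a) Let $\lambda_n^{(0)}=4\pi^2(\pm\frac23+2n)^2$, $n\in\{0,1,2,\dots\}$, with $u_{n1}^{(0)}(x)=\sin(\sqrt{\lambda_n^{(0)}}x)/\sqrt{\lambda_n^{(0)}}$, $u_{n2}^{(0)}(x)=\sin(\sqrt{\lambda_n^{(0)}}(1-x))/\sqrt{\lambda_n^{(0)}}$ (with $\sqrt{\lambda_n^{(0)}}>0$), and assume $$r_n=\frac{(2+\sqrt3)\,\frac{11}{3}\|q\|_{0,1}\left(1+\frac{16}{3}+2\sqrt{\frac{88}{9}}\right)}{\sqrt3\sqrt{\lambda_n^{(0)}}}<1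 .$$ Then the series $\lambda_n=\sum_{j\ge0}\lambda_n^{(j)}$, $u_n=\sum_{j\ge0}u_n^{(j)}$ converge to the corresponding eigensolution $(\lambda_n,u_n)$ of the problem above, and there exist constants $c>0,\varepsilon>0$ such that, with $C=c/(1-r_n)$, for all $m\ge0$ $$\|u_n-\overset{m}{u}_n\|_\infty\le\frac{3C}{8(m+1)^{1+\varepsilon}\sqrt{\lambda_n^{(0)}}}\,r_n^{m+1},\qquad |\lambda_n-\overset{m}{\lambda}_n|\le\frac{C}{(m+1)^{1+\varepsilon}R}\,r_n^{m}.$$ (b) Let $\lambda_n^{(0)}=4\pi^2n^2$, $n\in\{1,2,\dots\}$, with $u_{n1}^{(0)}(x)=\frac{\sin(2\pi nx)}{2\pi n}$, $u_{n2}^{(0)}(x)=\frac{(-1)^n+1}{2\pi n}\sin(2\pi nx)$, and assume $r_n=\frac{1}{\pi nR}<1$. Then the series $\lambda_n=\sum_{j\ge0}\lambda_n^{(j)}$, $u_n=\sum_{j\ge0}u_n^{(j)}$ converge to the corresponding eigensolution $(\lambda_n,u_n)$ of the problem above, and there exist constants $c>0,\varepsilon>0$ such that, with $C=c/(1-r_n)$, for all $m\ge0$ $$|\lambda_n-\overset{m}{\lambda}_n|\le\frac{C}{(m+1)^{1+\varepsilon}R}\,r_n^{m},$$ and $\|u_n-\overset{m}{u}_n\|_\infty\le\frac{3C}{8\pi n(m+1)^{1+\varepsilon}}r_n^{m+1}$ if $n$ is even, while $\|u_n-\overset{m}{u}_n\|_\infty\le\frac{C}{8\pi n(m+1)^{1+\varepsilon}}r_n^{m+1}$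 if $n$ is odd.
   Context: Notation: a function $u$ on $[0,1]$ is a pair $(u_1,u_2)$ with $u_1$ on $[0,\frac12]$ and $u_2$ on $[\frac12,1]$; $\|u\|_\infty=\max\{\sup_{[0,1/2]}|u_1|,\sup_{[1/2,1]}|u_2|\}$ and $\|q\|_{0,1}=\int_0^1|q(x)|\,dx$. The jump at $\frac12$ is $[f(\frac12)]=f_2(\frac12)-f_1(\frac12)$. FD-method (functional-discrete method): the trial (zero-order) eigenpair $(\lambda_n^{(0)},u_n^{(0)})$ is an exact solution of the problem with $q\equiv0$ (given explicitly in (a) and (b)). For $j=0,1,2,\dots$, given $\lambda_n^{(0)},\dots,\lambda_n^{(j)}$ and $u_n^{(0)},\dots,u_n^{(j)}$, the correction $(\lambda_n^{(j+1)},u_n^{(j+1)})$ is defined as the (unique) real number $\lambda_n^{(j+1)}$ and function $u_n^{(j+1)}=(u_{n1}^{(j+1)},u_{n2}^{(j+1)})$ such that $$u_{ni}^{(j+1)\prime\prime}+\lambda_n^{(0)}u_{ni}^{(j+1)}=F_{ni}^{(j+1)},\quad i=1,2\ (\text{on }(0,\tfrac12)\text{ and }(\tfrac12,1)\text{ respectively}),$$ $$u_{n1}^{(j+1)}(0)=u_{n2}^{(j+1)}(1)=0,\quad u_{n1}^{(j+1)\prime}(0)=0,\quad [u_n^{(j+1)}(\tfrac12)]=0,\quad [u_n^{(j+1)\prime}(\tfrac12)]=0,$$ where $F_{ni}^{(j+1)}(x)=-\sum_{p=0}^{j}\lambda_n^{(j+1-p)}u_{ni}^{(p)}(x)+q(x)u_{ni}^{(j)}(x)$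 (the value $\lambda_n^{(j+1)}$ is fixed by the solvability of this overdetermined problem). The rank-$m$ approximation is $\overset{m}{\lambda}_n=\sum_{j=0}^m\lambda_n^{(j)}$, $\overset{m}{u}_{ni}=\sum_{j=0}^m u_{ni}^{(j)}$. *)

theory Defs
  imports "HOL-Analysis.Analysis"
begin

text \<open>u'' = g on [a,b] in the absolutely-continuous (Caratheodory) sense:
  du is the derivative of u on [a,b] (one-sided at the endpoints) and
  du is an indefinite integral of g.\<close>
definition sol2 :: "real \<Rightarrow> real \<Rightarrow> (real \<Rightarrow> real) \<Rightarrow> (real \<Rightarrow> real) \<Rightarrow> (real \<Rightarrow> real) \<Rightarrow> bool" where
  "sol2 a b u du g \<longleftrightarrow>
     (\<forall>x\<in>{a..b}. (u has_real_derivative du x) (at x within {a..b})) \<and>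
     g integrable_on {a..b} \<and>
     (\<forall>x\<in>{a..b}. du x = du a + integral {a..x} g)"

definition L1norm :: "(real \<Rightarrow> real) \<Rightarrow> real" where
  "L1norm q = integral {0..1} (\<lambda>x. \<bar>q x\<bar>)"

definition Rconst :: "(real \<Rightarrow> real) \<Rightarrow> real" where
  "Rconst q = 1 / ((11/3) * L1norm q * (1 + 16/3 + 2 * sqrt (88/9)))"

definition eig_sol :: "(real \<Rightarrow> real) \<Rightarrow> real \<Rightarrow> (real \<Rightarrow> real) \<Rightarrow> (real \<Rightarrow> real) \<Rightarrow> bool" where
  "eig_sol q Lam u1 u2 \<longleftrightarrow>
     (\<exists>du1 du2.
        sol2 0 (1/2) u1 du1 (\<lambda>x. (q x - Lam) * u1 x) \<and>
        sol2 (1/2) 1 u2 du2 (\<lambda>x. (q x - Lam) * u2 x) \<and>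
        u1 0 = 0 \<and> u2 1 = 0 \<and> du1 0 = 1 \<and>
        u2 (1/2) - u1 (1/2) = 0 \<and> du2 (1/2) - du1 (1/2) = 1)"

definition fd_step :: "(real \<Rightarrow> real) \<Rightarrow> (nat \<Rightarrow> real) \<Rightarrow> (nat \<Rightarrow> real \<Rightarrow> real) \<Rightarrow> (nat \<Rightarrow> real \<Rightarrow> real) \<Rightarrow> nat \<Rightarrow> bool" where
  "fd_step q lam U1 U2 j \<longleftrightarrow>
     (let F1 = (\<lambda>x. - (\<Sum>p\<le>j. lam (j + 1 - p) * U1 p x) + q x * U1 j x);
          F2 = (\<lambda>x. - (\<Sum>p\<le>j. lam (j + 1 - p) * U2 p x) + q x * U2 j x)
      in (\<exists>d1 d2.
           sol2 0 (1/2) (U1 (j+1)) d1 (\<lambda>x. F1 x - lam 0 * U1 (j+1) x) \<and>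
           sol2 (1/2) 1 (U2 (j+1)) d2 (\<lambda>x. F2 x - lam 0 * U2 (j+1) x) \<and>
           U1 (j+1) 0 = 0 \<and> U2 (j+1) 1 = 0 \<and> d1 0 = 0 \<and>
           U2 (j+1) (1/2) - U1 (j+1) (1/2) = 0 \<and> d2 (1/2) - d1 (1/2) = 0))"

definition fd_seq :: "(real \<Rightarrow> real) \<Rightarrow> real \<Rightarrow> (real \<Rightarrow> real) \<Rightarrow> (real \<Rightarrow> real) \<Rightarrow>
    (nat \<Rightarrow> real) \<Rightarrow> (nat \<Rightarrow> real \<Rightarrow> real) \<Rightarrow> (nat \<Rightarrow> real \<Rightarrow> real) \<Rightarrow> bool" where
  "fd_seq q lam0 u01 u02 lam U1 U2 \<longleftrightarrow>
     lam 0 = lam0 \<and> U1 0 = u01 \<and> U2 0 = u02 \<and> (\<forall>j. fd_step q lam U1 U2 j)"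

end

theory Submission
  imports Defs
begin

text \<open>The corrections vanish to first order at 0, so by variation of constants \<open>u\<^sub>j\<^sub>+\<^sub>1\<close> is
  \<open>\<integral>\<^sub>0\<^sup>x sin (\<omega> (x - t)) F\<^sub>j\<^sub>+\<^sub>1(t) dt / \<omega>\<close> with \<open>\<omega>\<^sup>2 = \<lambda>\<^sub>0\<close>, across the point 1/2, and \<open>\<lambda>\<^sub>j\<^sub>+\<^sub>1\<close> is
  determined by the condition at 1. Since the trial function satisfies \<open>\<bar>u\<^sub>0\<bar> \<le> 4 \<bar>\<integral>\<^sub>0\<^sup>1 sin (\<omega> (1 - t)) u\<^sub>0(t) dt\<bar>\<close>
  in all cases, the norms of \<open>\<lambda>\<^sub>j\<close> and \<open>u\<^sub>j\<close> satisfy one quadratic recursion, and hence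
  decay like \<open>\<kappa>\<^sup>j\<close> with \<open>\<kappa> = 90 \<parallel>q\<parallel> / \<omega>\<close>. As \<open>\<kappa> < r\<^sub>n\<close> unless \<open>q\<close> vanishes almost everywhere, the
  remaining factor \<open>(\<kappa> / r\<^sub>n)\<^sup>m\<close> pays for \<open>(m + 1)\<^sup>2\<close>, i.e. one can take \<open>\<epsilon> = 1\<close>. The limit solves the
  eigenvalue problem by Cauchy's product formula and dominated convergence.\<close>

section \<open>Caratheodory solutions of second-order equations\<close>

text \<open>Since \<open>q\<close> is merely integrable, u'' = g holds only in integrated form, and
  u' is an indefinite integral to which the classical product rule cannot be applied at every point.
  Variation of constants therefore rests on an integration by parts proved for indefinite integrals.
  The corrections have neither a jump nor a kink at 1/2, so each of them is one solution on [0,1];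
  only the trial function has a kink, and it enters their equations as a continuous factor. The
  condition at 1 reads \<open>\<lambda>\<^sub>j\<^sub>+\<^sub>1\<close> times D = a known integral,
  where D is the integral of sin (\<omega> (1 - t)) against the trial function. All quantitative
  input is thus the ratio of a bound b of the trial function to |D|: b \<le> 4 |D| gives the factor
  4 for the eigenvalue corrections and 5 = 1 + 4 for the functions. The prefactors of the claim are
  absorbed by the free constant c; only its rate matters. If the norm of \<open>q\<close> is 0, then
  \<open>Rconst q\<close> and the rate are 0 by the convention 1 / 0 = 0, and the bounds hold
  because all corrections vanish.\<close>

lemma absolutely_integrable_cont_mult:
  fixes f g :: "real \<Rightarrow> real"
  assumes "f absolutely_integrable_on {a..b}" "continuous_on {a..b} g"
  shows "(\<lambda>x. g x * f x) absolutely_integrable_on {a..b}"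
proof (rule absolutely_integrable_bounded_measurable_product_real)
  show "g \<in> borel_measurable (lebesgue_on {a..b})"
    using assms(2) by (intro continuous_imp_measurable_on_sets_lebesgue) auto
  show "bounded (g ` {a..b})"
    using assms(2) compact_continuous_image compact_imp_bounded by blast
qed (use assms in auto)

lemma integral_abs_bound_real:
  fixes f g :: "real \<Rightarrow> real"
  assumes "f integrable_on S" "g integrable_on S" "\<And>x. x \<in> S \<Longrightarrow> \<bar>f x\<bar> \<le> g x"
  shows "\<bar>integral S f\<bar> \<le> integral S g"
  using Henstock_Kurzweil_Integration.integral_norm_bound_integral[of f S g] assms by auto

text \<open>The integral of \<open>f\<close> need not be differentiable, so the two sides cannot be
  differentiated separately. Their difference \<open>E\<close> still has derivative 0 everywhere:
  its increment over [y, z] is at most \<open>2 * L * (z - y)\<close> times the integral of |f| over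
  [y, z], and this integral tends to 0 as z approaches y.\<close>

lemma integral_parts_indefinite:
  fixes f \<phi> \<phi>' :: "real \<Rightarrow> real"
  assumes f: "f absolutely_integrable_on {a..b}"
    and deriv: "\<And>x. x \<in> {a..b} \<Longrightarrow> (\<phi> has_real_derivative \<phi>' x) (at x within {a..b})"
    and cont: "continuous_on {a..b} \<phi>'"
    and x: "x \<in> {a..b}"
  shows "\<phi> x * integral {a..x} f
    = integral {a..x} (\<lambda>t. \<phi> t * f t) + integral {a..x} (\<lambda>t. \<phi>' t * integral {a..t} f)"
proof -
  define A where "A = (\<lambda>t. integral {a..t} f)"
  define H where "H = (\<lambda>t. integral {a..t} (\<lambda>s. \<bar>f s\<bar>))"
  define k where "k = (\<lambda>t. \<phi> t * f t + \<phi>' t * A t)"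
  define E where "E = (\<lambda>t. \<phi> t * A t - integral {a..t} k)"
  have contphi: "continuous_on {a..b} \<phi>"
    using deriv by (meson DERIV_continuous_on)
  have fi: "f integrable_on {a..b}" and afi: "(\<lambda>s. \<bar>f s\<bar>) integrable_on {a..b}"
    using f by (auto simp: absolutely_integrable_on_def)
  have contA: "continuous_on {a..b} A" unfolding A_def
    by (rule indefinite_integral_continuous_1[OF fi])
  have contH: "continuous_on {a..b} H" unfolding H_def
    by (rule indefinite_integral_continuous_1[OF afi])
  have pfi: "(\<lambda>t. \<phi> t * f t) integrable_on {a..b}"
    using absolutely_integrable_cont_mult[OF f contphi] by (simp add: set_lebesgue_integral_eq_integral)
  have pAi: "(\<lambda>t. \<phi>' t * A t) integrable_on {a..b}"
    by (intro integrable_continuous_real continuous_intros cont contA)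
  have ki: "k integrable_on {a..b}" unfolding k_def
    by (intro integrable_add pfi pAi)
  obtain L where L: "\<And>t. t \<in> {a..b} \<Longrightarrow> \<bar>\<phi>' t\<bar> \<le> L" and "L \<ge> 0"
  proof -
    have "bounded (\<phi>' ` {a..b})"
      using cont compact_continuous_image compact_imp_bounded by blast
    then obtain K where "K > 0" "\<forall>x\<in>{a..b}. \<bar>\<phi>' x\<bar> \<le> K" unfolding bounded_pos by auto
    then show ?thesis using that[of K] by auto
  qed
  have lip: "\<bar>\<phi> y - \<phi> z\<bar> \<le> L * \<bar>y - z\<bar>" if "y \<in> {a..b}" "z \<in> {a..b}" for y z
    using field_differentiable_bound[of "{a..b}" \<phi> \<phi>' L y z] deriv L that by auto
  have key: "\<bar>E z - E y\<bar> \<le> 2 * L * (z - y) * (H z - H y)" if yz: "a \<le> y" "y \<le> z" "z \<le> b" for y z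
  proof -
    have sub: "g integrable_on {u..v}" if "g integrable_on {a..b}" "a \<le> u" "v \<le> b" for g :: "real \<Rightarrow> real" and u v
      using integrable_on_subinterval[OF that(1), of u v] that by auto
    have comb: "integral {a..z} g = integral {a..y} g + integral {y..z} g" if "g integrable_on {a..b}" for g :: "real \<Rightarrow> real"
      using Henstock_Kurzweil_Integration.integral_combine[of a y z g] yz sub[OF that, of a z] by auto
    have combt: "A t = A y + integral {y..t} f" if "t \<in> {y..z}" for t
      unfolding A_def using Henstock_Kurzweil_Integration.integral_combine[of a y t f] yz that sub[OF fi, of a t] by auto
    have fz: "f integrable_on {y..z}" and afz: "(\<lambda>s. \<bar>f s\<bar>) integrable_on {y..z}"
      and kz: "k integrable_on {y..z}" and pz: "\<phi>' integrable_on {y..z}"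
      using sub fi afi ki integrable_continuous_real[OF cont] yz by auto
    have Hz: "H z - H y = integral {y..z} (\<lambda>s. \<bar>f s\<bar>)"
      unfolding H_def using comb[OF afi] by auto
    have ftc: "integral {y..z} \<phi>' = \<phi> z - \<phi> y"
    proof (rule integral_unique, rule fundamental_theorem_of_calculus[OF yz(2)])
      fix t assume "t \<in> {y..z}"
      then show "(\<phi> has_vector_derivative \<phi>' t) (at t within {y..z})"
        using deriv[of t] yz has_field_derivative_subset[of \<phi> "\<phi>' t" t "{a..b}" "{y..z}"]
        by (auto simp: has_real_derivative_iff_has_vector_derivative)
    qed
    \<comment> \<open>With \<open>\<phi>\<close> frozen at \<open>z\<close> and \<open>A\<close>
      frozen at \<open>y\<close>, the increment of the product is exactly an integral over [y, z].
      Comparison with \<open>k\<close> leaves one error of the size of the increment of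
      \<open>\<phi>\<close> and one of the size of the increment of \<open>A\<close>.\<close>
    have "E z - E y = \<phi> z * integral {y..z} f + (\<phi> z - \<phi> y) * A y - integral {y..z} k"
      unfolding E_def using comb[OF ki] combt[of z] yz by (auto simp: algebra_simps)
    also have "\<dots> = integral {y..z} (\<lambda>t. \<phi> z * f t + \<phi>' t * A y) - integral {y..z} k"
      using fz pz ftc by (subst Henstock_Kurzweil_Integration.integral_add) (auto intro: integrable_on_mult_right integrable_on_mult_left)
    also have "\<dots> = integral {y..z} (\<lambda>t. \<phi> z * f t + \<phi>' t * A y - k t)"
      using fz kz pz
      by (intro Henstock_Kurzweil_Integration.integral_diff[symmetric] integrable_add integrable_on_mult_right integrable_on_mult_left)
    finally have eq: "E z - E y = integral {y..z} (\<lambda>t. \<phi> z * f t + \<phi>' t * A y - k t)" .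
    have "\<bar>integral {y..z} (\<lambda>t. \<phi> z * f t + \<phi>' t * A y - k t)\<bar>
        \<le> integral {y..z} (\<lambda>t. L * (z - y) * \<bar>f t\<bar> + L * (H z - H y))"
    proof (rule integral_abs_bound_real)
      show "(\<lambda>t. \<phi> z * f t + \<phi>' t * A y - k t) integrable_on {y..z}"
        using fz kz pz by (intro integrable_diff integrable_add integrable_on_mult_right integrable_on_mult_left)
      show "(\<lambda>t. L * (z - y) * \<bar>f t\<bar> + L * (H z - H y)) integrable_on {y..z}"
        using afz by (intro integrable_add integrable_on_mult_right integrable_const_ivl)
      fix t assume t: "t \<in> {y..z}"
      have 1: "\<phi> z * f t + \<phi>' t * A y - k t = (\<phi> z - \<phi> t) * f t + \<phi>' t * (A y - A t)"
        by (simp add: k_def algebra_simps)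
      have "\<bar>A y - A t\<bar> = \<bar>integral {y..t} f\<bar>" using combt[OF t] by simp
      also have "\<dots> \<le> integral {y..t} (\<lambda>s. \<bar>f s\<bar>)"
        using t yz sub[OF fi, of y t] sub[OF afi, of y t] by (intro integral_abs_bound_real) auto
      also have "\<dots> \<le> integral {y..z} (\<lambda>s. \<bar>f s\<bar>)"
        using t yz sub[OF afi, of y t] afz by (intro integral_subset_le) auto
      finally have 2: "\<bar>A y - A t\<bar> \<le> H z - H y" using Hz by simp
      have 3: "\<bar>\<phi> z - \<phi> t\<bar> \<le> L * (z - y)"
      proof -
        have "\<bar>\<phi> z - \<phi> t\<bar> \<le> L * \<bar>z - t\<bar>" using t yz by (intro lip) auto
        also have "\<dots> \<le> L * (z - y)" using t \<open>L \<ge> 0\<close> by (intro mult_left_mono) auto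
        finally show ?thesis .
      qed
      have "\<bar>(\<phi> z - \<phi> t) * f t + \<phi>' t * (A y - A t)\<bar> \<le> \<bar>\<phi> z - \<phi> t\<bar> * \<bar>f t\<bar> + \<bar>\<phi>' t\<bar> * \<bar>A y - A t\<bar>"
        by (metis abs_mult abs_triangle_ineq)
      also have "\<dots> \<le> L * (z - y) * \<bar>f t\<bar> + L * (H z - H y)"
        using 2 3 L[of t] t yz \<open>L \<ge> 0\<close> by (intro add_mono mult_mono) auto
      finally show "\<bar>\<phi> z * f t + \<phi>' t * A y - k t\<bar> \<le> L * (z - y) * \<bar>f t\<bar> + L * (H z - H y)"
        using 1 by simp
    qed
    also have "\<dots> = L * (z - y) * integral {y..z} (\<lambda>t. \<bar>f t\<bar>) + (z - y) * (L * (H z - H y))"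
      using afz yz by (subst Henstock_Kurzweil_Integration.integral_add) (auto intro: integrable_on_mult_right)
    also have "\<dots> = 2 * L * (z - y) * (H z - H y)" using Hz by (simp add: algebra_simps)
    finally show ?thesis using eq by simp
  qed
  have key': "\<bar>E z - E y\<bar> \<le> 2 * L * \<bar>H z - H y\<bar> * \<bar>z - y\<bar>" if "y \<in> {a..b}" "z \<in> {a..b}" for y z
  proof (cases "y \<le> z")
    case True
    have "\<bar>E z - E y\<bar> \<le> 2 * L * (z - y) * (H z - H y)" using key[of y z] True that by auto
    also have "\<dots> \<le> 2 * L * (z - y) * \<bar>H z - H y\<bar>" using True \<open>L \<ge> 0\<close> by (intro mult_left_mono) auto
    also have "\<dots> = 2 * L * \<bar>H z - H y\<bar> * \<bar>z - y\<bar>" using True by simp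
    finally show ?thesis .
  next
    case False
    have "\<bar>E y - E z\<bar> \<le> 2 * L * (y - z) * (H y - H z)" using key[of z y] False that by auto
    also have "\<dots> \<le> 2 * L * (y - z) * \<bar>H y - H z\<bar>" using False \<open>L \<ge> 0\<close> by (intro mult_left_mono) auto
    also have "\<dots> = 2 * L * \<bar>H z - H y\<bar> * \<bar>z - y\<bar>" using False by (simp add: abs_minus_commute)
    finally show ?thesis by (simp add: abs_minus_commute)
  qed
  have "(E has_real_derivative 0) (at y within {a..b})" if y: "y \<in> {a..b}" for y
    unfolding has_field_derivative_iff
  proof (rule Lim_null_comparison)
    show "\<forall>\<^sub>F z in at y within {a..b}. norm ((E z - E y) / (z - y)) \<le> 2 * L * \<bar>H z - H y\<bar>"
      unfolding eventually_at_filter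
      using key'[OF y] by (auto simp: divide_le_eq)
    have "(H \<longlongrightarrow> H y) (at y within {a..b})"
      using contH y by (simp add: continuous_on_def)
    then have "((\<lambda>z. 2 * L * \<bar>H z - H y\<bar>) \<longlongrightarrow> 2 * L * \<bar>H y - H y\<bar>) (at y within {a..b})"
      by (intro tendsto_intros)
    then show "((\<lambda>z. 2 * L * \<bar>H z - H y\<bar>) \<longlongrightarrow> 0) (at y within {a..b})" by simp
  qed
  then obtain c where c: "\<And>y. y \<in> {a..b} \<Longrightarrow> E y = c"
    using has_field_derivative_zero_constant[of "{a..b}" E] by auto
  have "E x = E a" using c[of x] c[of a] x by auto
  also have "E a = 0" by (simp add: E_def A_def)
  finally have "\<phi> x * A x = integral {a..x} k" by (simp add: E_def)
  moreover have "integral {a..x} k = integral {a..x} (\<lambda>t. \<phi> t * f t) + integral {a..x} (\<lambda>t. \<phi>' t * A t)"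
    unfolding k_def using x integrable_on_subinterval[OF pfi, of a x] integrable_on_subinterval[OF pAi, of a x]
    by (intro Henstock_Kurzweil_Integration.integral_add) auto
  ultimately have "\<phi> x * A x = integral {a..x} (\<lambda>t. \<phi> t * f t) + integral {a..x} (\<lambda>t. \<phi>' t * A t)"
    by (rule trans)
  then show ?thesis unfolding A_def .
qed

section \<open>Restriction, gluing and continuity of solutions\<close>

lemma sol2_D:
  assumes "sol2 a b u d g"
  shows "x \<in> {a..b} \<Longrightarrow> (u has_real_derivative d x) (at x within {a..b})"
    and "g integrable_on {a..b}"
    and "x \<in> {a..b} \<Longrightarrow> d x = d a + integral {a..x} g"
  using assms unfolding sol2_def by blast+

lemma sol2_cong:
  assumes s: "sol2 a b u du g" and uv: "\<And>x. x \<in> {a..b} \<Longrightarrow> u x = v x"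
    and duv: "\<And>x. x \<in> {a..b} \<Longrightarrow> du x = dv x" and gh: "\<And>x. x \<in> {a..b} \<Longrightarrow> g x = h x"
  shows "sol2 a b v dv h"
  unfolding sol2_def
proof (intro conjI ballI)
  show "h integrable_on {a..b}" by (rule integrable_eq[OF sol2_D(2)[OF s] gh])
  fix x assume x: "x \<in> {a..b}"
  have "(u has_real_derivative dv x) (at x within {a..b})" 
    using sol2_D(1)[OF s x] duv[OF x] by simp
  then show "(v has_real_derivative dv x) (at x within {a..b})"
    by (rule has_field_derivative_transform_within[OF _ zero_less_one x]) (rule uv)
  have "integral {a..x} g = integral {a..x} h"
    by (rule integral_cong) (rule gh, use x in auto)
  moreover have "a \<in> {a..b}" using x by simp
  ultimately show "dv x = dv a + integral {a..x} h"
    using sol2_D(3)[OF s x] duv[OF x] duv[of a] by simp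
qed

lemma sol2_split:
  assumes "sol2 a c u d g" "a \<le> b" "b \<le> c"
  shows "sol2 a b u d g" "sol2 b c u d g"
proof -
  have gi: "g integrable_on {a..c}" using assms(1) by (rule sol2_D(2))
  have sub: "g integrable_on {x..y}" if "a \<le> x" "y \<le> c" for x y
    using integrable_on_subinterval[OF gi, of x y] that by auto
  have der: "(u has_real_derivative d x) (at x within S)" if "x \<in> S" "S \<subseteq> {a..c}" for x S
    using has_field_derivative_subset[OF sol2_D(1)[OF assms(1)]] that by blast
  show "sol2 a b u d g"
    unfolding sol2_def
  proof (intro conjI ballI)
    fix x assume x: "x \<in> {a..b}"
    show "(u has_real_derivative d x) (at x within {a..b})" using der[of x "{a..b}"] x assms by auto
    show "d x = d a + integral {a..x} g" using sol2_D(3)[OF assms(1), of x] x assms by auto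
  qed (rule sub, use assms in auto)
  have "d x = d b + integral {b..x} g" if x: "x \<in> {b..c}" for x
  proof -
    have "d x = d a + integral {a..x} g" "d b = d a + integral {a..b} g"
      using sol2_D(3)[OF assms(1), of x] sol2_D(3)[OF assms(1), of b] assms(2,3) x by auto
    moreover have "integral {a..b} g + integral {b..x} g = integral {a..x} g"
      using assms(2,3) x sub[of a x] by (intro Henstock_Kurzweil_Integration.integral_combine) auto
    ultimately show ?thesis by simp
  qed
  moreover have "(u has_real_derivative d x) (at x within {b..c})" if "x \<in> {b..c}" for x
    using der[of x "{b..c}"] that assms by auto
  ultimately show "sol2 b c u d g"
    unfolding sol2_def using sub[of b c] assms(2) by blast
qed

lemma sol2_glue:
  assumes 1: "sol2 a b u d g" and 2: "sol2 b c u d g" and abc: "a \<le> b" "b \<le> c"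
  shows "sol2 a c u d g"
  unfolding sol2_def
proof (intro conjI ballI)
  have U: "{a..c} = {a..b} \<union> {b..c}" using abc by auto
  have g1: "g integrable_on {a..b}" and g2: "g integrable_on {b..c}" using 1 2 by (auto dest: sol2_D(2))
  then show gi: "g integrable_on {a..c}" using Henstock_Kurzweil_Integration.integrable_combine[OF abc] by blast
  fix x assume x: "x \<in> {a..c}"
  \<comment> \<open>The derivative within each piece is claimed for every \<open>x\<close> of the
    union. Outside a closed piece the filter is trivial and the claim is vacuous, so the two filters
    can be joined without distinguishing the position of \<open>x\<close>.\<close>
  have "(u has_real_derivative d x) (at x within {a..b})"
  proof (cases "x \<in> {a..b}")
    case True
    then show ?thesis by (rule sol2_D(1)[OF 1])
  next
    case False
    then have "\<not> x islimpt {a..b}" using closed_limpt[of "{a..b}"] closed_atLeastAtMost by blast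
    then have "at x within {a..b} = bot" by (simp add: trivial_limit_within)
    then show ?thesis by (simp add: has_field_derivative_iff)
  qed
  moreover have "(u has_real_derivative d x) (at x within {b..c})"
  proof (cases "x \<in> {b..c}")
    case True
    then show ?thesis by (rule sol2_D(1)[OF 2])
  next
    case False
    then have "\<not> x islimpt {b..c}" using closed_limpt[of "{b..c}"] closed_atLeastAtMost by blast
    then have "at x within {b..c} = bot" by (simp add: trivial_limit_within)
    then show ?thesis by (simp add: has_field_derivative_iff)
  qed
  ultimately show "(u has_real_derivative d x) (at x within {a..c})"
    unfolding has_field_derivative_iff unfolding U at_within_union by (rule filterlim_sup)
  show "d x = d a + integral {a..x} g"
  proof (cases "x \<le> b")
    case True
    with x have "x \<in> {a..b}" by simp
    then show ?thesis by (rule sol2_D(3)[OF 1])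
  next
    case False
    have "integral {a..b} g + integral {b..x} g = integral {a..x} g"
      using abc x False integrable_on_subinterval[OF gi, of a x]
      by (intro Henstock_Kurzweil_Integration.integral_combine) auto
    moreover have "d x = d b + integral {b..x} g" "d b = d a + integral {a..b} g"
      using x False abc by (auto intro!: sol2_D(3)[OF 2] sol2_D(3)[OF 1])
    ultimately show ?thesis by simp
  qed
qed

lemma sol2_continuous:
  assumes "sol2 a b u d g"
  shows "continuous_on {a..b} u" "continuous_on {a..b} d"
proof -
  show "continuous_on {a..b} u" by (rule DERIV_continuous_on[OF sol2_D(1)[OF assms]])
  have "continuous_on {a..b} (\<lambda>x. d a + integral {a..x} g)"
    by (intro continuous_intros indefinite_integral_continuous_1 sol2_D(2)[OF assms])
  then show "continuous_on {a..b} d"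
    by (rule continuous_on_eq) (metis sol2_D(3)[OF assms])
qed

section \<open>Variation of constants for the forced oscillator\<close>

lemma sol2_oscillator_eq_Duhamel:
  assumes s: "sol2 a b u d (\<lambda>x. F x - \<omega>\<^sup>2 * u x)" and F: "F absolutely_integrable_on {a..b}"
    and ini: "u a = 0" "d a = 0" and x: "x \<in> {a..b}"
  shows "\<omega> * u x = integral {a..x} (\<lambda>t. sin (\<omega> * (x - t)) * F t)"
proof -
  define g where "g = (\<lambda>t. F t - \<omega>\<^sup>2 * u t)"
  note s = s[folded g_def]
  have sx: "sol2 a x u d g" using sol2_split(1)[OF s, of x] x by auto
  have Fx: "F absolutely_integrable_on {a..x}"
    using absolutely_integrable_on_subinterval[OF F, of a x] x by auto
  note cu = sol2_continuous(1)[OF sx] and cd = sol2_continuous(2)[OF sx]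
  have ax: "a \<le> x" using x by simp
  have gx: "g absolutely_integrable_on {a..x}" unfolding g_def
    by (intro set_integral_diff(1) Fx absolutely_integrable_continuous_real continuous_intros cu)
  have dt: "d t = integral {a..t} g" if "t \<in> {a..x}" for t
    using sol2_D(3)[OF sx that] ini by simp
  \<comment> \<open>Parts with \<open>sin (\<omega> * (x - t))\<close>, which vanishes at t = x: no
    boundary term survives.\<close>
  have p: "0 = integral {a..x} (\<lambda>t. sin (\<omega> * (x - t)) * g t)
      + integral {a..x} (\<lambda>t. (- (\<omega> * cos (\<omega> * (x - t)))) * d t)"
  proof -
    have "sin (\<omega> * (x - x)) * integral {a..x} g = integral {a..x} (\<lambda>t. sin (\<omega> * (x - t)) * g t)
      + integral {a..x} (\<lambda>t. (- (\<omega> * cos (\<omega> * (x - t)))) * integral {a..t} g)"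
      by (rule integral_parts_indefinite[OF gx])
        (use ax in \<open>auto intro!: derivative_eq_intros continuous_intros\<close>)
    also have "integral {a..x} (\<lambda>t. (- (\<omega> * cos (\<omega> * (x - t)))) * integral {a..t} g)
      = integral {a..x} (\<lambda>t. (- (\<omega> * cos (\<omega> * (x - t)))) * d t)"
      by (rule integral_cong) (simp add: dt)
    finally show ?thesis by simp
  qed
  have ftc: "((\<lambda>t. \<omega> * sin (\<omega> * (x - t)) * u t + cos (\<omega> * (x - t)) * d t) has_integral u x) {a..x}"
  proof -
    have "((\<lambda>t. \<omega> * sin (\<omega> * (x - t)) * u t + cos (\<omega> * (x - t)) * d t) has_integral
        cos (\<omega> * (x - x)) * u x - cos (\<omega> * (x - a)) * u a) {a..x}"
    proof (rule fundamental_theorem_of_calculus[OF ax])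
      fix t assume t: "t \<in> {a..x}"
      show "((\<lambda>t. cos (\<omega> * (x - t)) * u t) has_vector_derivative
          \<omega> * sin (\<omega> * (x - t)) * u t + cos (\<omega> * (x - t)) * d t) (at t within {a..x})"
        unfolding has_real_derivative_iff_has_vector_derivative[symmetric]
        by (auto intro!: derivative_eq_intros sol2_D(1)[OF sx t])
    qed
    then show ?thesis using ini by simp
  qed
  have i1: "(\<lambda>t. sin (\<omega> * (x - t)) * g t) integrable_on {a..x}"
    by (intro set_lebesgue_integral_eq_integral(1) absolutely_integrable_cont_mult[OF gx] continuous_intros)
  have i2: "(\<lambda>t. (- (\<omega> * cos (\<omega> * (x - t)))) * d t) integrable_on {a..x}"
    by (intro integrable_continuous_real continuous_intros cd)
  \<comment> \<open>Adding \<open>\<omega>\<close> times the identity for the derivative of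
    \<open>cos (\<omega> * (x - t)) * u t\<close> cancels the terms with \<open>d\<close> and the
    part of \<open>g\<close> that contains \<open>u\<close>; only \<open>F\<close> remains under the
    integral.\<close>
  have "((\<lambda>t. sin (\<omega> * (x - t)) * g t + (- (\<omega> * cos (\<omega> * (x - t)))) * d t
     + \<omega> * (\<omega> * sin (\<omega> * (x - t)) * u t + cos (\<omega> * (x - t)) * d t)) has_integral (0 + \<omega> * u x)) {a..x}"
    using has_integral_add[OF has_integral_add[OF integrable_integral[OF i1] integrable_integral[OF i2]]
      has_integral_mult_right[OF ftc, of \<omega>]] p by simp
  moreover have "(\<lambda>t. sin (\<omega> * (x - t)) * g t + (- (\<omega> * cos (\<omega> * (x - t)))) * d t
     + \<omega> * (\<omega> * sin (\<omega> * (x - t)) * u t + cos (\<omega> * (x - t)) * d t))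
     = (\<lambda>t. sin (\<omega> * (x - t)) * F t)"
    by (rule ext) (simp add: g_def algebra_simps power2_eq_square)
  ultimately show ?thesis by (simp add: integral_unique)
qed

text \<open>The addition theorem moves the parameter \<open>x\<close> out of the integral, leaving
  products of smooth functions with the indefinite integrals \<open>A\<close> and \<open>B\<close>.
  Differentiation under the integral sign is thereby avoided: integration by parts of the four
  products shows that \<open>u\<close> is the integral of \<open>d\<close>, where the terms with
  \<open>F\<close> cancel, and that \<open>d\<close> is the integral of
  \<open>F - \<omega>\<^sup>2 * u\<close>, where they add up to \<open>F\<close> by
  Pythagoras.\<close>

lemma Duhamel_sol2_oscillator:
  assumes F: "F absolutely_integrable_on {a..b}" and \<omega>: "\<omega> \<noteq> 0"
  defines "u \<equiv> \<lambda>x. integral {a..x} (\<lambda>t. sin (\<omega> * (x - t)) * F t) / \<omega>"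
  shows "\<exists>d. sol2 a b u d (\<lambda>x. F x - \<omega>\<^sup>2 * u x) \<and> d a = 0"
proof -
  define A where "A = (\<lambda>x. integral {a..x} (\<lambda>t. cos (\<omega> * t) * F t))"
  define B where "B = (\<lambda>x. integral {a..x} (\<lambda>t. sin (\<omega> * t) * F t))"
  define d where "d = (\<lambda>x. cos (\<omega> * x) * A x + sin (\<omega> * x) * B x)"
  have ca: "(\<lambda>t. cos (\<omega> * t) * F t) absolutely_integrable_on {a..b}"
    by (intro absolutely_integrable_cont_mult F continuous_intros)
  have sa: "(\<lambda>t. sin (\<omega> * t) * F t) absolutely_integrable_on {a..b}"
    by (intro absolutely_integrable_cont_mult F continuous_intros)
  have hk: "f integrable_on {a..y}" if "f absolutely_integrable_on {a..b}" "y \<in> {a..b}" for f :: "real \<Rightarrow> real" and y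
    using absolutely_integrable_on_subinterval[OF that(1), of a y] that(2)
    by (auto simp: absolutely_integrable_on_def)
  have cA: "continuous_on {a..b} A" and cB: "continuous_on {a..b} B"
    unfolding A_def B_def using ca sa
    by (intro indefinite_integral_continuous_1; simp add: absolutely_integrable_on_def)+
  have cd: "continuous_on {a..b} d" unfolding d_def by (intro continuous_intros cA cB)
  have u_eq: "u x = (sin (\<omega> * x) * A x - cos (\<omega> * x) * B x) / \<omega>" if x: "x \<in> {a..b}" for x
  proof -
    have "integral {a..x} (\<lambda>t. sin (\<omega> * (x - t)) * F t)
      = integral {a..x} (\<lambda>t. sin (\<omega> * x) * (cos (\<omega> * t) * F t) - cos (\<omega> * x) * (sin (\<omega> * t) * F t))"
      by (rule integral_cong) (simp add: right_diff_distrib sin_diff algebra_simps)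
    also have "\<dots> = sin (\<omega> * x) * A x - cos (\<omega> * x) * B x"
      unfolding A_def B_def using hk[OF ca x] hk[OF sa x]
      by (subst Henstock_Kurzweil_Integration.integral_diff) (auto intro!: integrable_on_mult_right)
    finally show ?thesis by (simp add: u_def)
  qed
  have subc: "f integrable_on {a..y}" if "continuous_on {a..b} f" "y \<in> {a..b}" for f :: "real \<Rightarrow> real" and y
    using that continuous_on_subset[of "{a..b}" f "{a..y}"] by (intro integrable_continuous_real) auto
  have sA: "sin (\<omega> * x) * A x = integral {a..x} (\<lambda>t. sin (\<omega> * t) * (cos (\<omega> * t) * F t))
      + integral {a..x} (\<lambda>t. (\<omega> * cos (\<omega> * t)) * A t)" if x: "x \<in> {a..b}" for x
    unfolding A_def
    by (rule integral_parts_indefinite[OF ca]) (use x in \<open>auto intro!: derivative_eq_intros continuous_intros\<close>)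
  have cA': "cos (\<omega> * x) * A x = integral {a..x} (\<lambda>t. cos (\<omega> * t) * (cos (\<omega> * t) * F t))
      + integral {a..x} (\<lambda>t. (- (\<omega> * sin (\<omega> * t))) * A t)" if x: "x \<in> {a..b}" for x
    unfolding A_def
    by (rule integral_parts_indefinite[OF ca]) (use x in \<open>auto intro!: derivative_eq_intros continuous_intros\<close>)
  have sB: "sin (\<omega> * x) * B x = integral {a..x} (\<lambda>t. sin (\<omega> * t) * (sin (\<omega> * t) * F t))
      + integral {a..x} (\<lambda>t. (\<omega> * cos (\<omega> * t)) * B t)" if x: "x \<in> {a..b}" for x
    unfolding B_def
    by (rule integral_parts_indefinite[OF sa]) (use x in \<open>auto intro!: derivative_eq_intros continuous_intros\<close>)
  have cB': "cos (\<omega> * x) * B x = integral {a..x} (\<lambda>t. cos (\<omega> * t) * (sin (\<omega> * t) * F t))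
      + integral {a..x} (\<lambda>t. (- (\<omega> * sin (\<omega> * t))) * B t)" if x: "x \<in> {a..b}" for x
    unfolding B_def
    by (rule integral_parts_indefinite[OF sa]) (use x in \<open>auto intro!: derivative_eq_intros continuous_intros\<close>)
  have hi: "((\<lambda>t. \<phi> t * f t) has_integral integral {a..x} (\<lambda>t. \<phi> t * f t)) {a..x}"
    if "f absolutely_integrable_on {a..b}" "continuous_on {a..b} \<phi>" "x \<in> {a..b}" for \<phi> f :: "real \<Rightarrow> real" and x
    using hk[OF absolutely_integrable_cont_mult[OF that(1,2)] that(3)] by (rule integrable_integral)
  have hc: "((\<lambda>t. \<phi> t * f t) has_integral integral {a..x} (\<lambda>t. \<phi> t * f t)) {a..x}"
    if "continuous_on {a..b} f" "continuous_on {a..b} \<phi>" "x \<in> {a..b}" for \<phi> f :: "real \<Rightarrow> real" and x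
    using that by (intro integrable_integral subc continuous_intros)
  have u_int: "u x = integral {a..x} d" if x: "x \<in> {a..b}" for x
  proof -
    have "((\<lambda>t. sin (\<omega> * t) * (cos (\<omega> * t) * F t) + (\<omega> * cos (\<omega> * t)) * A t
        - (cos (\<omega> * t) * (sin (\<omega> * t) * F t) + (- (\<omega> * sin (\<omega> * t))) * B t))
        has_integral (sin (\<omega> * x) * A x - cos (\<omega> * x) * B x)) {a..x}"
      unfolding sA[OF x] cB'[OF x]
      by (intro has_integral_diff has_integral_add hi hc ca sa cA cB continuous_intros x)
    moreover have "(\<lambda>t. sin (\<omega> * t) * (cos (\<omega> * t) * F t) + (\<omega> * cos (\<omega> * t)) * A t
        - (cos (\<omega> * t) * (sin (\<omega> * t) * F t) + (- (\<omega> * sin (\<omega> * t))) * B t)) = (\<lambda>t. \<omega> * d t)"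
      by (rule ext) (simp add: d_def algebra_simps)
    ultimately have "((\<lambda>t. \<omega> * d t) has_integral \<omega> * u x) {a..x}"
      using u_eq[OF x] \<omega> by simp
    from integral_unique[OF this] show ?thesis using \<omega> by simp
  qed
  have d_int: "((\<lambda>x. F x - \<omega>\<^sup>2 * u x) has_integral d x) {a..x}" if x: "x \<in> {a..b}" for x
  proof -
    have "((\<lambda>t. (cos (\<omega> * t) * (cos (\<omega> * t) * F t) + (- (\<omega> * sin (\<omega> * t))) * A t)
        + (sin (\<omega> * t) * (sin (\<omega> * t) * F t) + (\<omega> * cos (\<omega> * t)) * B t))
        has_integral (cos (\<omega> * x) * A x + sin (\<omega> * x) * B x)) {a..x}"
      unfolding cA'[OF x] sB[OF x]
      by (intro has_integral_add hi hc ca sa cA cB continuous_intros x)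
    moreover have "(cos (\<omega> * t) * (cos (\<omega> * t) * F t) + (- (\<omega> * sin (\<omega> * t))) * A t)
        + (sin (\<omega> * t) * (sin (\<omega> * t) * F t) + (\<omega> * cos (\<omega> * t)) * B t) = F t - \<omega>\<^sup>2 * u t"
      if "t \<in> {a..x}" for t
    proof -
      have "(cos (\<omega> * t))\<^sup>2 * F t + (sin (\<omega> * t))\<^sup>2 * F t = F t"
        by (simp add: distrib_right[symmetric])
      moreover have "\<omega>\<^sup>2 * u t = \<omega> * (sin (\<omega> * t) * A t - cos (\<omega> * t) * B t)"
        using u_eq[of t] that x \<omega> by (simp add: power2_eq_square)
      ultimately show ?thesis by (simp add: algebra_simps power2_eq_square)
    qed
    ultimately show ?thesis unfolding d_def by (rule has_integral_eq[rotated])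
  qed
  have "d a = 0" by (simp add: d_def A_def B_def)
  have "sol2 a b u d (\<lambda>x. F x - \<omega>\<^sup>2 * u x)"
  proof (cases "a \<le> b")
    case True
    show ?thesis unfolding sol2_def
    proof (intro conjI ballI)
      show "(\<lambda>x. F x - \<omega>\<^sup>2 * u x) integrable_on {a..b}"
        using d_int[of b] True by (auto simp: has_integral_integrable)
      fix x assume x: "x \<in> {a..b}"
      show "(u has_real_derivative d x) (at x within {a..b})"
        by (rule has_field_derivative_transform_within[OF integral_has_real_derivative[OF cd x] zero_less_one x])
          (simp add: u_int)
      show "d x = d a + integral {a..x} (\<lambda>x. F x - \<omega>\<^sup>2 * u x)"
        using d_int[OF x] \<open>d a = 0\<close> by (simp add: integral_unique)
    qed
  qed (simp add: sol2_def integrable_on_empty)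
  with \<open>d a = 0\<close> show ?thesis by blast
qed

section \<open>Termwise summation of solutions\<close>

lemma sol2_suminf:
  fixes V e g :: "nat \<Rightarrow> real \<Rightarrow> real"
  assumes s: "\<And>j. sol2 a b (V j) (e j) (g j)" and ab: "a \<le> b"
    and h: "h integrable_on {a..b}" and h0: "\<And>x. x \<in> {a..b} \<Longrightarrow> 0 \<le> h x"
    and A: "summable A" and A0: "\<And>j. 0 \<le> A j"
    and g: "\<And>j x. x \<in> {a..b} \<Longrightarrow> \<bar>g j x\<bar> \<le> A j * h x"
    and ea: "summable (\<lambda>j. \<bar>e j a\<bar>)" and Va: "summable (\<lambda>j. V j a)"
  shows "sol2 a b (\<lambda>x. \<Sum>j. V j x) (\<lambda>x. \<Sum>j. e j x) (\<lambda>x. \<Sum>j. g j x)"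
    and "\<And>x. x \<in> {a..b} \<Longrightarrow> summable (\<lambda>j. \<bar>e j x\<bar>)"
proof -
  define E where "E = (\<lambda>j. \<bar>e j a\<bar> + A j * integral {a..b} h)"
  have sE: "summable E" unfolding E_def by (intro summable_add ea summable_mult2 A)
  have hx: "h integrable_on {a..x}" if "x \<in> {a..b}" for x
    using integrable_on_subinterval[OF h, of a x] that by auto
  have gx: "g j integrable_on {a..x}" if "x \<in> {a..b}" for j x
    using integrable_on_subinterval[OF sol2_D(2)[OF s], of a x] that by auto
  \<comment> \<open>A bound free of \<open>x\<close>: it gives uniform convergence of the
    differentiated series, hence termwise differentiability, and carries absolute summability from
    \<open>a\<close> to every point of the interval.\<close>
  have bnd: "\<bar>e j x\<bar> \<le> E j" if x: "x \<in> {a..b}" for j x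
  proof -
    have "\<bar>integral {a..x} (g j)\<bar> \<le> integral {a..x} (\<lambda>t. A j * h t)"
      using x by (intro integral_abs_bound_real gx integrable_on_mult_right hx g) auto
    also have "\<dots> = A j * integral {a..x} h" by simp
    also have "\<dots> \<le> A j * integral {a..b} h"
      using x h0 by (intro mult_left_mono A0 integral_subset_le hx h) auto
    finally show ?thesis using sol2_D(3)[OF s x, of j] unfolding E_def by linarith
  qed
  show sume: "summable (\<lambda>j. \<bar>e j x\<bar>)" if "x \<in> {a..b}" for x
    using bnd[OF that] by (intro summable_comparison_test[OF _ sE]) auto
  have "uniform_limit {a..b} (\<lambda>n x. \<Sum>j<n. e j x) (\<lambda>x. \<Sum>j. e j x) sequentially"
    using bnd by (intro Weierstrass_m_test[OF _ sE]) auto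
  from has_field_derivative_series[OF _ sol2_D(1)[OF s] this _ Va] ab
  obtain G where "\<forall>x\<in>{a..b}. (\<lambda>j. V j x) sums G x \<and> (G has_real_derivative (\<Sum>j. e j x)) (at x within {a..b})"
    by auto
  then have G: "\<And>x. x \<in> {a..b} \<Longrightarrow> (\<lambda>j. V j x) sums G x"
    "\<And>x. x \<in> {a..b} \<Longrightarrow> (G has_real_derivative (\<Sum>j. e j x)) (at x within {a..b})"
    by blast+
  have der: "((\<lambda>x. \<Sum>j. V j x) has_real_derivative (\<Sum>j. e j x)) (at x within {a..b})" if x: "x \<in> {a..b}" for x
    by (rule has_field_derivative_transform_within[OF G(2)[OF x] zero_less_one x]) (simp add: G(1) sums_unique)
  have sg: "summable (\<lambda>j. \<bar>g j x\<bar>)" if "x \<in> {a..b}" for x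
    using g[OF that] by (intro summable_comparison_test[OF _ summable_mult2[OF A, of "h x"]]) auto
  \<comment> \<open>The right-hand sides may be unbounded, as \<open>q\<close> is. Their partial
    sums are dominated by \<open>suminf A * h\<close>, so the integral is interchanged with the sum
    without uniform convergence.\<close>
  have dom: "(\<lambda>t. \<Sum>j. g j t) integrable_on {a..x}"
    "(\<lambda>k. integral {a..x} (\<lambda>t. \<Sum>j<k. g j t)) \<longlonglongrightarrow> integral {a..x} (\<lambda>t. \<Sum>j. g j t)"
    if x: "x \<in> {a..b}" for x
  proof -
    have 1: "(\<lambda>t. \<Sum>j<k. g j t) integrable_on {a..x}" for k
      by (intro integrable_sum gx x) simp
    have 2: "(\<lambda>t. suminf A * h t) integrable_on {a..x}" by (intro integrable_on_mult_right hx x)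
    have 3: "norm (\<Sum>j<k. g j t) \<le> suminf A * h t" if t: "t \<in> {a..x}" for k t
    proof -
      have tb: "t \<in> {a..b}" using t x by auto
      have "norm (\<Sum>j<k. g j t) \<le> (\<Sum>j<k. A j * h t)"
        using g[OF tb] by (intro sum_norm_le) auto
      also have "\<dots> = (\<Sum>j<k. A j) * h t" by (simp add: sum_distrib_right)
      also have "\<dots> \<le> suminf A * h t"
        using A0 by (intro mult_right_mono h0 tb sum_le_suminf A) auto
      finally show ?thesis .
    qed
    have 4: "(\<lambda>k. \<Sum>j<k. g j t) \<longlonglongrightarrow> (\<Sum>j. g j t)" if t: "t \<in> {a..x}" for t
      using t x by (intro summable_LIMSEQ[OF summable_rabs_cancel[OF sg]]) auto
    show "(\<lambda>t. \<Sum>j. g j t) integrable_on {a..x}"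
      "(\<lambda>k. integral {a..x} (\<lambda>t. \<Sum>j<k. g j t)) \<longlonglongrightarrow> integral {a..x} (\<lambda>t. \<Sum>j. g j t)"
      by (rule dominated_convergence[OF 1 2 3 4], assumption+)+
  qed
  have int: "(\<Sum>j. e j x) = (\<Sum>j. e j a) + integral {a..x} (\<lambda>t. \<Sum>j. g j t)" if x: "x \<in> {a..b}" for x
  proof -
    have "(\<lambda>k. (\<Sum>j<k. e j a) + integral {a..x} (\<lambda>t. \<Sum>j<k. g j t))
        \<longlonglongrightarrow> (\<Sum>j. e j a) + integral {a..x} (\<lambda>t. \<Sum>j. g j t)"
      using ab by (intro tendsto_add dom(2) x summable_LIMSEQ[OF summable_rabs_cancel[OF sume]]) auto
    moreover have "(\<Sum>j<k. e j a) + integral {a..x} (\<lambda>t. \<Sum>j<k. g j t) = (\<Sum>j<k. e j x)" for k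
    proof -
      have "integral {a..x} (\<lambda>t. \<Sum>j<k. g j t) = (\<Sum>j<k. integral {a..x} (g j))"
        by (intro integral_sum gx x) simp
      also have "(\<Sum>j<k. e j a) + \<dots> = (\<Sum>j<k. e j x)"
        by (simp add: sum.distrib[symmetric] sol2_D(3)[OF s x])
      finally show ?thesis .
    qed
    ultimately have "(\<lambda>k. \<Sum>j<k. e j x) \<longlonglongrightarrow> (\<Sum>j. e j a) + integral {a..x} (\<lambda>t. \<Sum>j. g j t)" by simp
    moreover have "(\<lambda>k. \<Sum>j<k. e j x) \<longlonglongrightarrow> (\<Sum>j. e j x)"
      by (intro summable_LIMSEQ[OF summable_rabs_cancel[OF sume]] x)
    ultimately show ?thesis by (rule LIMSEQ_unique[rotated])
  qed
  show "sol2 a b (\<lambda>x. \<Sum>j. V j x) (\<lambda>x. \<Sum>j. e j x) (\<lambda>x. \<Sum>j. g j x)"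
    unfolding sol2_def using ab by (intro conjI ballI der dom(1) int) auto
qed

section \<open>The quadratic recursion for the norms\<close>

lemma sum_convolution_le:
  fixes a b :: "nat \<Rightarrow> real"
  assumes "\<And>i. 0 \<le> a i" "\<And>i. 0 \<le> b i"
  shows "(\<Sum>m<k. \<Sum>p\<le>m. a p * b (m - p)) \<le> (\<Sum>i<k. a i) * (\<Sum>i<k. b i)"
proof -
  have "(\<Sum>m<k. \<Sum>p\<le>m. a p * b (m - p)) = (\<Sum>(i,j)\<in>{(i,j). i + j < k}. a i * b j)"
    by (rule sum.triangle_reindex[symmetric])
  also have "\<dots> \<le> (\<Sum>(i,j)\<in>{..<k} \<times> {..<k}. a i * b j)"
    using assms by (intro sum_mono2) auto
  also have "\<dots> = (\<Sum>i<k. a i) * (\<Sum>i<k. b i)"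
    by (simp add: sum_product sum.cartesian_product)
  finally show ?thesis .
qed

text \<open>Up to the factor \<open>\<omega> / 5\<close>, the scaled partial sums stay in the interval \<open>[0, 17 / 144]\<close>, which
  \<open>\<sigma> \<mapsto> 4 * \<sigma>\<^sup>2 + (1 + \<sigma>) / 18\<close> maps to itself; this is where the constant 90 = 5 * 18 comes from.\<close>

lemma quadratic_recursion_geometric:
  fixes l N :: "nat \<Rightarrow> real" and Q \<omega> :: real
  defines "S \<equiv> \<lambda>j. (\<Sum>p<j. l (j - p) * N (Suc p)) + Q * N j"
  assumes \<omega>: "\<omega> > 0" and Q: "Q \<ge> 0" and \<kappa>: "\<kappa> > 0" "90 * Q \<le> \<kappa> * \<omega>"
    and l0: "\<And>j. 0 \<le> l j" and N0: "\<And>j. 0 \<le> N j" "N 0 \<le> 1"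
    and lS: "\<And>j. l (Suc j) \<le> 4 * S j" and NS: "\<And>j. \<omega> * N (Suc j) \<le> 5 * S j"
  shows "N j \<le> \<kappa> ^ j \<and> l (Suc j) \<le> \<omega> * \<kappa> ^ Suc j"
proof -
  \<comment> \<open>Dividing index j + 1 by \<open>\<kappa> ^ Suc j\<close> turns the sum in
    \<open>S\<close> into an exact convolution, since the exponents k - p + 1 and p + 1 add up to k
    + 2. The value \<open>l 0\<close> never enters: \<lambda>_0 belongs to the homogeneous
    operator.\<close>
  define n where "n = (\<lambda>j. N (Suc j) / \<kappa> ^ Suc j)"
  define m where "m = (\<lambda>j. l (Suc j) / \<kappa> ^ Suc j)"
  define s where "s = (\<lambda>j. S j / \<kappa> ^ Suc j)"
  have S0: "0 \<le> S j" for j unfolding S_def by (intro add_nonneg_nonneg sum_nonneg mult_nonneg_nonneg l0 N0(1) Q)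
  have pos: "0 \<le> n j" "0 \<le> m j" "0 \<le> s j" for j
    using N0 l0 S0 \<kappa> by (auto simp: n_def m_def s_def)
  have ns: "\<omega> * n j \<le> 5 * s j" for j
    using NS[of j] \<kappa> divide_right_mono[OF NS[of j], of "\<kappa> ^ Suc j"] by (simp add: n_def s_def)
  have ms: "m j \<le> 4 * s j" for j
    using \<kappa> divide_right_mono[OF lS[of j], of "\<kappa> ^ Suc j"] by (simp add: m_def s_def)
  have s_0: "s 0 \<le> \<omega> / 90"
  proof -
    have "Q * N 0 \<le> Q * 1" using N0 Q by (intro mult_left_mono) auto
    also have "\<dots> \<le> \<kappa> * \<omega> / 90" using \<kappa> by simp
    finally show ?thesis using \<kappa> by (simp add: s_def S_def field_simps)
  qed
  have s_Suc: "s (Suc k) \<le> (\<Sum>p\<le>k. n p * m (k - p)) + \<omega> / 90 * n k" for k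
  proof -
    have "(\<Sum>p<Suc k. l (Suc k - p) * N (Suc p)) / \<kappa> ^ Suc (Suc k) = (\<Sum>p\<le>k. n p * m (k - p))"
      unfolding sum_divide_distrib lessThan_Suc_atMost
    proof (rule sum.cong)
      fix p assume "p \<in> {..k}"
      then have "\<kappa> ^ Suc (Suc k) = \<kappa> ^ Suc (k - p) * \<kappa> ^ Suc p" "Suc k - p = Suc (k - p)"
        by (auto simp: power_add[symmetric])
      then show "l (Suc k - p) * N (Suc p) / \<kappa> ^ Suc (Suc k) = n p * m (k - p)"
        by (simp only: n_def m_def times_divide_times_eq mult.commute)
    qed simp
    moreover have "Q * N (Suc k) / \<kappa> ^ Suc (Suc k) = (Q / \<kappa>) * n k" by (simp add: n_def)
    moreover have "(Q / \<kappa>) * n k \<le> \<omega> / 90 * n k"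
      using \<kappa> by (intro mult_right_mono pos) (simp add: field_simps)
    ultimately show ?thesis unfolding s_def S_def add_divide_distrib by linarith
  qed
  \<comment> \<open>In units of \<open>\<omega> / 5\<close> the induction iterates
    \<open>4 * \<sigma>\<^sup>2 + (1 + \<sigma>) / 18\<close>, whose fixed points are 1/9 = 16/144
    and 1/8 = 18/144; 17/144 is their midpoint. With k in place of 18, real fixed points in the
    positive range require k \<ge> 9 + 4 sqrt 5, about 17.94, so 18 is the least integer that
    works.\<close>
  have main: "(\<Sum>j<k. s j) \<le> 17 * \<omega> / 720" for k
  proof (induction k)
    case 0
    then show ?case using \<omega> by simp
  next
    case (Suc k)
    define \<sigma> where "\<sigma> = (\<Sum>j<k. s j)"
    have \<sigma>: "0 \<le> \<sigma>" "\<sigma> \<le> 17 * \<omega> / 720" using Suc pos by (auto simp: \<sigma>_def intro: sum_nonneg)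
    have n: "(\<Sum>j<k. n j) \<le> 5 / \<omega> * \<sigma>"
    proof -
      have "(\<Sum>j<k. n j) \<le> (\<Sum>j<k. 5 / \<omega> * s j)"
        using ns \<omega> by (intro sum_mono) (simp add: field_simps)
      then show ?thesis by (simp add: \<sigma>_def sum_distrib_left)
    qed
    have m: "(\<Sum>j<k. m j) \<le> 4 * \<sigma>"
      using sum_mono[of "{..<k}" m "\<lambda>j. 4 * s j"] ms by (simp add: \<sigma>_def sum_distrib_left)
    have "(\<Sum>j<Suc k. s j) = s 0 + (\<Sum>j<k. s (Suc j))" by (rule sum.lessThan_Suc_shift)
    also have "\<dots> \<le> \<omega> / 90 + (\<Sum>j<k. (\<Sum>p\<le>j. n p * m (j - p)) + \<omega> / 90 * n j)"
      by (intro add_mono s_0 sum_mono s_Suc)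
    also have "\<dots> = \<omega> / 90 + ((\<Sum>j<k. \<Sum>p\<le>j. n p * m (j - p)) + \<omega> / 90 * (\<Sum>j<k. n j))"
      by (simp add: sum.distrib sum_distrib_left)
    also have "\<dots> \<le> \<omega> / 90 + ((\<Sum>j<k. n j) * (\<Sum>j<k. m j) + \<omega> / 90 * (\<Sum>j<k. n j))"
      using sum_convolution_le[of n m k] pos by simp
    also have "\<dots> \<le> \<omega> / 90 + ((5 / \<omega> * (17 * \<omega> / 720)) * (4 * (17 * \<omega> / 720)) + \<omega> / 90 * (5 / \<omega> * (17 * \<omega> / 720)))"
    proof -
      have n': "(\<Sum>j<k. n j) \<le> 5 / \<omega> * (17 * \<omega> / 720)"
        using n \<sigma>(2) \<omega> mult_left_mono[OF \<sigma>(2), of "5 / \<omega>"] by auto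
      have m': "(\<Sum>j<k. m j) \<le> 4 * (17 * \<omega> / 720)" using m \<sigma>(2) by linarith
      show ?thesis using \<omega> n' m' pos
        by (intro add_mono order_refl mult_mono mult_left_mono sum_nonneg mult_nonneg_nonneg) auto
    qed
    also have "\<dots> \<le> 17 * \<omega> / 720" using \<omega> by (simp add: field_simps)
    finally show ?case .
  qed
  have sb: "s j \<le> 17 * \<omega> / 720" for j
  proof -
    have "s j \<le> (\<Sum>j<Suc j. s j)" using pos by (intro member_le_sum) auto
    also have "\<dots> \<le> 17 * \<omega> / 720" by (rule main)
    finally show ?thesis .
  qed
  have "m j \<le> \<omega>" using ms[of j] sb[of j] \<omega> by simp
  then have "l (Suc j) \<le> \<omega> * \<kappa> ^ Suc j" using \<kappa> by (simp add: m_def divide_le_eq)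
  moreover have "N j \<le> \<kappa> ^ j"
  proof (cases j)
    case 0
    then show ?thesis using N0 by simp
  next
    case (Suc i)
    have "\<omega> * n i \<le> \<omega>" using ns[of i] sb[of i] \<omega> by linarith
    then have "n i \<le> 1" using \<omega> by simp
    then show ?thesis using \<kappa> Suc by (simp add: n_def divide_le_eq)
  qed
  ultimately show ?thesis by blast
qed

text \<open>The rate \<open>90 * Q / \<omega>\<close> may be 0, and then one cannot divide by its
  powers. The bounds hold for every larger rate and pass to the limit from the right.\<close>

lemma quadratic_recursion_geometric_limit:
  fixes l N :: "nat \<Rightarrow> real" and Q \<omega> :: real
  defines "S \<equiv> \<lambda>j. (\<Sum>p<j. l (j - p) * N (Suc p)) + Q * N j"
  assumes \<omega>: "\<omega> > 0" and Q: "Q \<ge> 0"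
    and l0: "\<And>j. 0 \<le> l j" and N0: "\<And>j. 0 \<le> N j" "N 0 \<le> 1"
    and lS: "\<And>j. l (Suc j) \<le> 4 * S j" and NS: "\<And>j. \<omega> * N (Suc j) \<le> 5 * S j"
  shows "N j \<le> (90 * Q / \<omega>) ^ j" and "l (Suc j) \<le> \<omega> * (90 * Q / \<omega>) ^ Suc j"
proof -
  have *: "N j \<le> x ^ j \<and> l (Suc j) \<le> \<omega> * x ^ Suc j" if "x > 90 * Q / \<omega>" for x
  proof (rule quadratic_recursion_geometric[where Q = Q])
    show "x > 0" using that Q \<omega> by (smt (verit) divide_nonneg_pos)
    show "90 * Q \<le> x * \<omega>" using that \<omega> by (simp add: field_simps)
  qed (use assms in auto)
  define \<kappa> where "\<kappa> = 90 * Q / \<omega>"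
  have ev: "\<forall>\<^sub>F x in at_right \<kappa>. N j \<le> x ^ j \<and> l (Suc j) \<le> \<omega> * x ^ Suc j"
    using eventually_at_right_less[of \<kappa>] by (rule eventually_mono) (rule *, simp add: \<kappa>_def)
  have lim: "((\<lambda>x. x ^ i) \<longlongrightarrow> \<kappa> ^ i) (at_right \<kappa>)" for i by (intro tendsto_intros)
  show "N j \<le> (90 * Q / \<omega>) ^ j"
    unfolding \<kappa>_def[symmetric]
    by (rule tendsto_lowerbound[OF lim eventually_mono[OF ev]]) simp_all
  show "l (Suc j) \<le> \<omega> * (90 * Q / \<omega>) ^ Suc j"
    unfolding \<kappa>_def[symmetric]
    by (rule tendsto_lowerbound[OF tendsto_mult_left[OF lim] eventually_mono[OF ev]]) simp_all
qed

text \<open>The gap between \<open>\<kappa>\<close> and \<open>r\<close> pays for the polynomial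
  weight. If both are 0, the exponent m + 1 is positive and both sides vanish.\<close>

lemma geometric_tail_le:
  fixes \<kappa> r :: real
  assumes "0 \<le> \<kappa>" "\<kappa> < r \<or> \<kappa> = 0 \<and> r = 0" "r < 1"
  shows "\<exists>G>0. \<forall>m. \<kappa> ^ (m + 1) / (1 - \<kappa>) \<le> G / real (m + 1) powr (1 + 1) * r ^ (m + 1)"
proof (cases "r = 0")
  case True
  then show ?thesis using assms by (intro exI[of _ 1]) auto
next
  case False
  then have r: "0 < r" "\<kappa> < r" using assms by auto
  \<comment> \<open>\<open>n * y ^ n\<close> is bounded because y < 1; squaring it bounds
    \<open>n\<^sup>2 * (\<kappa> / r) ^ n\<close>, which is the weight with exponent 1 + 1.\<close>
  define y where "y = sqrt (\<kappa> / r)"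
  have y: "0 \<le> y" "y < 1" "y\<^sup>2 = \<kappa> / r" using r assms by (auto simp: y_def)
  have "(\<lambda>n. of_nat n * y ^ n) \<longlonglongrightarrow> 0" using y by (intro powser_times_n_limit_0) auto
  then have "Bseq (\<lambda>n. of_nat n * y ^ n)" using convergent_imp_Bseq convergentI by blast
  then obtain K where K: "K > 0" "\<And>n. \<bar>real n * y ^ n\<bar> \<le> K" by (auto simp: Bseq_def)
  have "\<kappa> ^ n / (1 - \<kappa>) \<le> (K\<^sup>2 / (1 - \<kappa>)) / real n powr (1 + 1) * r ^ n" if n: "n > 0" for n :: nat
  proof -
    have "(real n * y ^ n)\<^sup>2 \<le> K\<^sup>2" using K(2)[of n] y by (intro power_mono) auto
    also have "(real n * y ^ n)\<^sup>2 = (real n)\<^sup>2 * (\<kappa> / r) ^ n"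
      unfolding power_mult_distrib y(3)[symmetric] by (simp add: power_mult[symmetric] mult.commute)
    finally have "(real n)\<^sup>2 * \<kappa> ^ n \<le> K\<^sup>2 * r ^ n" using r by (simp add: power_divide field_simps)
    then have "\<kappa> ^ n \<le> K\<^sup>2 / (real n)\<^sup>2 * r ^ n" using n by (simp add: field_simps)
    then have "\<kappa> ^ n / (1 - \<kappa>) \<le> (K\<^sup>2 / (real n)\<^sup>2 * r ^ n) / (1 - \<kappa>)"
      using r assms by (intro divide_right_mono) auto
    moreover have "real n powr (1 + 1) = (real n)\<^sup>2" using powr_realpow[of "real n" 2] n by simp
    ultimately show ?thesis by (simp add: mult.commute)
  qed
  then have "\<forall>m. \<kappa> ^ (m + 1) / (1 - \<kappa>) \<le> (K\<^sup>2 / (1 - \<kappa>)) / real (m + 1) powr (1 + 1) * r ^ (m + 1)"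
    by (metis add_gr_0 zero_less_one)
  moreover have "K\<^sup>2 / (1 - \<kappa>) > 0" using K(1) r assms by simp
  ultimately show ?thesis by blast
qed

section \<open>The glued problem\<close>

text \<open>The geometric bound is assumed only beyond \<open>m\<close>, because the bound for the
  eigenvalue corrections starts at index 1 and does not cover \<lambda>_0.\<close>

lemma suminf_minus_atMost_le_geometric:
  fixes f :: "nat \<Rightarrow> real"
  assumes f: "\<And>j. j > m \<Longrightarrow> \<bar>f j\<bar> \<le> C * \<kappa> ^ j" and \<kappa>: "0 \<le> \<kappa>" "\<kappa> < 1"
    and s: "summable f"
  shows "\<bar>suminf f - (\<Sum>j\<le>m. f j)\<bar> \<le> C * (\<kappa> ^ (m + 1) / (1 - \<kappa>))"
proof -
  have g: "(\<lambda>n. C * \<kappa> ^ (n + Suc m)) sums (C * \<kappa> ^ Suc m * (1 / (1 - \<kappa>)))"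
    using sums_mult[OF geometric_sums[of \<kappa>], of "C * \<kappa> ^ Suc m"] \<kappa> by (simp add: power_add mult_ac)
  have "norm (\<Sum>n. f (n + Suc m)) \<le> (\<Sum>n. C * \<kappa> ^ (n + Suc m))"
  proof (rule norm_suminf_le[OF _ sums_summable[OF g]])
    show "norm (f (n + Suc m)) \<le> C * \<kappa> ^ (n + Suc m)" for n
      unfolding real_norm_def by (rule f) simp
  qed
  also have "\<dots> = C * \<kappa> ^ Suc m * (1 / (1 - \<kappa>))" by (rule sums_unique[OF g, symmetric])
  finally show ?thesis
    using suminf_minus_initial_segment[OF s, of "Suc m"] by (simp add: lessThan_Suc_atMost)
qed

definition glue :: "(real \<Rightarrow> real) \<Rightarrow> (real \<Rightarrow> real) \<Rightarrow> real \<Rightarrow> real" where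
  "glue u v = (\<lambda>x. if x \<le> 1/2 then u x else v x)"

lemma glue_left: "x \<le> 1/2 \<Longrightarrow> glue u v x = u x"
  by (simp add: glue_def)

lemma glue_right:
  assumes "u (1/2) = v (1/2)" "1/2 \<le> x"
  shows "glue u v x = v x"
proof (cases "x = 1/2")
  case True
  show ?thesis unfolding glue_def True using assms(1) by simp
next
  case False
  then show ?thesis using assms(2) by (simp add: glue_def)
qed

text \<open>This collects what the two families of trial solutions share. \<open>b\<close> is any
  bound of the trial function, not necessarily its maximum, and \<open>nondegenerate\<close> is the
  quantitative solvability condition: it keeps the coefficient of the unknown eigenvalue correction
  away from 0 relative to \<open>b\<close>.\<close>

locale fd_trial =
  fixes q u01 u02 d01 d02 :: "real \<Rightarrow> real" and \<omega> b :: real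
  assumes q: "q absolutely_integrable_on {0..1}"
    and \<omega>: "\<omega> > 0"
    and s01: "sol2 0 (1/2) u01 d01 (\<lambda>x. - (\<omega>\<^sup>2 * u01 x))"
    and s02: "sol2 (1/2) 1 u02 d02 (\<lambda>x. - (\<omega>\<^sup>2 * u02 x))"
    and bc: "u01 0 = 0" "u02 1 = 0" "d01 0 = 1"
    and jump: "u01 (1/2) = u02 (1/2)" "d02 (1/2) - d01 (1/2) = 1"
    and b: "b > 0" "\<And>x. x \<in> {0..1/2} \<Longrightarrow> \<bar>u01 x\<bar> \<le> b" "\<And>x. x \<in> {1/2..1} \<Longrightarrow> \<bar>u02 x\<bar> \<le> b"
    and nondegenerate: "b \<le> 4 * \<bar>integral {0..1/2} (\<lambda>t. sin (\<omega> * (1 - t)) * u01 t)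
        + integral {1/2..1} (\<lambda>t. sin (\<omega> * (1 - t)) * u02 t)\<bar>"
begin

definition w0 :: "real \<Rightarrow> real" where "w0 = glue u01 u02"

text \<open>The coefficient of \<open>\<lambda>\<^sub>j\<^sub>+\<^sub>1\<close> when the boundary
  condition at 1 is written by variation of constants; the same for all j.\<close>

definition D :: real where "D = integral {0..1} (\<lambda>t. sin (\<omega> * (1 - t)) * w0 t)"

lemma w0_left: "x \<le> 1/2 \<Longrightarrow> w0 x = u01 x"
  unfolding w0_def by (rule glue_left)

lemma w0_right: "1/2 \<le> x \<Longrightarrow> w0 x = u02 x"
  unfolding w0_def by (rule glue_right) (rule jump(1))

lemma w0_continuous: "continuous_on {0..1} w0"
proof -
  have "continuous_on {0..1/2} w0"
    by (rule continuous_on_eq[OF sol2_continuous(1)[OF s01]]) (simp add: w0_left)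
  moreover have "continuous_on {1/2..1} w0"
    by (rule continuous_on_eq[OF sol2_continuous(1)[OF s02]]) (simp add: w0_right)
  moreover have "{0..1::real} = {0..1/2} \<union> {1/2..1}" by auto
  ultimately show ?thesis using continuous_on_closed_Un[of "{0..1/2}" "{1/2..1}" w0] by auto
qed

lemma w0_bound: "x \<in> {0..1} \<Longrightarrow> \<bar>w0 x\<bar> \<le> b"
  using b(2)[of x] b(3)[of x] w0_left[of x] w0_right[of x] by (cases "x \<le> 1/2") auto

lemma b_le_D: "b \<le> 4 * \<bar>D\<bar>"
proof -
  have "D = integral {0..1/2} (\<lambda>t. sin (\<omega> * (1 - t)) * w0 t) + integral {1/2..1} (\<lambda>t. sin (\<omega> * (1 - t)) * w0 t)"
    unfolding D_def
    by (rule Henstock_Kurzweil_Integration.integral_combine[symmetric])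
      (auto intro!: integrable_continuous_real continuous_intros w0_continuous)
  also have "integral {0..1/2} (\<lambda>t. sin (\<omega> * (1 - t)) * w0 t) = integral {0..1/2} (\<lambda>t. sin (\<omega> * (1 - t)) * u01 t)"
    by (rule integral_cong) (simp add: w0_left)
  also have "integral {1/2..1} (\<lambda>t. sin (\<omega> * (1 - t)) * w0 t) = integral {1/2..1} (\<lambda>t. sin (\<omega> * (1 - t)) * u02 t)"
    by (rule integral_cong) (simp add: w0_right)
  finally show ?thesis using nondegenerate by simp
qed

lemma D_nonzero: "D \<noteq> 0"
  using b_le_D b(1) by auto

text \<open>The part of the right-hand side \<open>F\<^sub>j\<^sub>+\<^sub>1\<close> that does not involve the unknown \<open>\<lambda>\<^sub>j\<^sub>+\<^sub>1\<close>.\<close>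

definition H :: "(nat \<Rightarrow> real) \<Rightarrow> (nat \<Rightarrow> real \<Rightarrow> real) \<Rightarrow> nat \<Rightarrow> real \<Rightarrow> real" where
  "H lam W j x = q x * W j x - (\<Sum>p<j. lam (j - p) * W (Suc p) x)"

text \<open>The matching conditions at 1/2 are absorbed by requiring one solution on the whole of
  [0,1].\<close>

definition glued_step :: "(nat \<Rightarrow> real) \<Rightarrow> (nat \<Rightarrow> real \<Rightarrow> real) \<Rightarrow> nat \<Rightarrow> (real \<Rightarrow> real) \<Rightarrow> bool" where
  "glued_step lam W j d \<longleftrightarrow>
     sol2 0 1 (W (Suc j)) d (\<lambda>x. (H lam W j x - lam (Suc j) * w0 x) - \<omega>\<^sup>2 * W (Suc j) x) \<and>
     d 0 = 0 \<and> W (Suc j) 0 = 0 \<and> W (Suc j) 1 = 0"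

lemma fd_rhs_eq:
  assumes "V 0 x = w0 x" "\<And>p. V p x = W p x"
  shows "- (\<Sum>p\<le>j. lam (j + 1 - p) * V p x) + q x * V j x - l0 * V (j + 1) x
    = (H lam W j x - lam (Suc j) * w0 x) - l0 * W (Suc j) x"
proof -
  have "(\<Sum>p\<le>j. lam (j + 1 - p) * V p x) = lam (Suc j) * V 0 x + (\<Sum>p<j. lam (j - p) * V (Suc p) x)"
    unfolding lessThan_Suc_atMost[symmetric] sum.lessThan_Suc_shift by simp
  then show ?thesis using assms by (simp add: H_def)
qed

text \<open>A correction and its derivative match at 1/2, so both can be glued. For the trial
  function the values alone match, which suffices because it occurs only in right-hand
  sides.\<close>

lemma glue_fd_seq:
  assumes fd: "fd_seq q (\<omega>\<^sup>2) u01 u02 lam U1 U2"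
  defines "W \<equiv> \<lambda>j. glue (U1 j) (U2 j)"
  shows "W 0 = w0" and "\<exists>d. glued_step lam W j d"
    and "x \<in> {0..1/2} \<Longrightarrow> U1 j x = W j x" and "x \<in> {1/2..1} \<Longrightarrow> U2 j x = W j x"
proof -
  have st: "fd_step q lam U1 U2 j" for j using fd by (simp add: fd_seq_def)
  have l0: "lam 0 = \<omega>\<^sup>2" and U0: "U1 0 = u01" "U2 0 = u02" using fd by (auto simp: fd_seq_def)
  have mid: "U1 j (1/2) = U2 j (1/2)" for j
  proof (cases j)
    case 0
    then show ?thesis using U0 jump by simp
  next
    case (Suc i)
    then show ?thesis using st[of i] unfolding fd_step_def Let_def by auto
  qed
  show W0: "W 0 = w0" by (simp add: W_def w0_def U0)
  have L: "U1 j x = W j x" if "x \<in> {0..1/2}" for j x using that by (simp add: W_def glue_left)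
  have R: "U2 j x = W j x" if "x \<in> {1/2..1}" for j x using that mid by (simp add: W_def glue_right)
  show "x \<in> {0..1/2} \<Longrightarrow> U1 j x = W j x" "x \<in> {1/2..1} \<Longrightarrow> U2 j x = W j x"
    by (fact L, fact R)
  from st[of j] obtain d1 d2 where
    1: "sol2 0 (1/2) (U1 (j+1)) d1
        (\<lambda>x. - (\<Sum>p\<le>j. lam (j + 1 - p) * U1 p x) + q x * U1 j x - lam 0 * U1 (j+1) x)" and
    2: "sol2 (1/2) 1 (U2 (j+1)) d2
        (\<lambda>x. - (\<Sum>p\<le>j. lam (j + 1 - p) * U2 p x) + q x * U2 j x - lam 0 * U2 (j+1) x)" and
    3: "U1 (j+1) 0 = 0" "U2 (j+1) 1 = 0" "d1 0 = 0" "d2 (1/2) = d1 (1/2)"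
    unfolding fd_step_def Let_def by auto
  have "sol2 0 1 (W (Suc j)) (glue d1 d2)
      (\<lambda>x. (H lam W j x - lam (Suc j) * w0 x) - \<omega>\<^sup>2 * W (Suc j) x)"
  proof (rule sol2_glue[where b = "1/2"])
    show "sol2 0 (1/2) (W (Suc j)) (glue d1 d2)
      (\<lambda>x. (H lam W j x - lam (Suc j) * w0 x) - \<omega>\<^sup>2 * W (Suc j) x)"
    proof (rule sol2_cong[OF 1])
      fix x :: real assume x: "x \<in> {0..1/2}"
      show "U1 (j+1) x = W (Suc j) x" using L[OF x] by simp
      show "d1 x = glue d1 d2 x" using x by (simp add: glue_left)
      show "- (\<Sum>p\<le>j. lam (j + 1 - p) * U1 p x) + q x * U1 j x - lam 0 * U1 (j+1) x
          = (H lam W j x - lam (Suc j) * w0 x) - \<omega>\<^sup>2 * W (Suc j) x"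
        unfolding l0 by (rule fd_rhs_eq) (use L[OF x] W0 in auto)
    qed
    show "sol2 (1/2) 1 (W (Suc j)) (glue d1 d2)
      (\<lambda>x. (H lam W j x - lam (Suc j) * w0 x) - \<omega>\<^sup>2 * W (Suc j) x)"
    proof (rule sol2_cong[OF 2])
      fix x :: real assume x: "x \<in> {1/2..1}"
      show "U2 (j+1) x = W (Suc j) x" using R[OF x] by simp
      show "d2 x = glue d1 d2 x" using x 3 by (simp add: glue_right)
      show "- (\<Sum>p\<le>j. lam (j + 1 - p) * U2 p x) + q x * U2 j x - lam 0 * U2 (j+1) x
          = (H lam W j x - lam (Suc j) * w0 x) - \<omega>\<^sup>2 * W (Suc j) x"
        unfolding l0 by (rule fd_rhs_eq) (use R[OF x] W0 in auto)
    qed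
  qed auto
  moreover have "glue d1 d2 0 = 0" "W (Suc j) 0 = 0" "W (Suc j) 1 = 0"
    using 3 L[of 0 "Suc j"] R[of 1 "Suc j"] by (auto simp: glue_left)
  ultimately show "\<exists>d. glued_step lam W j d" unfolding glued_step_def by blast
qed

text \<open>\<open>fd_seq\<close> demands equality with the trial functions on the whole line,
  whereas \<open>w0\<close> agrees with each of them only on its side of 1/2. Hence the entry with
  index 0 is replaced separately in the two halves.\<close>

lemma fd_seq_of_glued:
  assumes l0: "lam 0 = \<omega>\<^sup>2" and W0: "W 0 = w0" and st: "\<And>j. \<exists>d. glued_step lam W j d"
  shows "fd_seq q (\<omega>\<^sup>2) u01 u02 lam (W(0 := u01)) (W(0 := u02))"
  unfolding fd_seq_def
proof (intro conjI allI)
  fix j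
  let ?U1 = "W(0 := u01)" and ?U2 = "W(0 := u02)"
  have L: "W p x = ?U1 p x" if "x \<in> {0..1/2}" for p x using that W0 by (simp add: w0_left)
  have R: "W p x = ?U2 p x" if "x \<in> {1/2..1}" for p x using that W0 by (simp add: w0_right)
  from st[of j] obtain d where
    s: "sol2 0 1 (W (Suc j)) d (\<lambda>x. (H lam W j x - lam (Suc j) * w0 x) - \<omega>\<^sup>2 * W (Suc j) x)" and
    z: "d 0 = 0" "W (Suc j) 0 = 0" "W (Suc j) 1 = 0" unfolding glued_step_def by blast
  have "sol2 0 (1/2) (?U1 (j+1)) d
        (\<lambda>x. - (\<Sum>p\<le>j. lam (j + 1 - p) * ?U1 p x) + q x * ?U1 j x - lam 0 * ?U1 (j+1) x)"
  proof (rule sol2_cong[OF sol2_split(1)[OF s, of "1/2"]])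
    fix x :: real assume x: "x \<in> {0..1/2}"
    show "(H lam W j x - lam (Suc j) * w0 x) - \<omega>\<^sup>2 * W (Suc j) x
      = - (\<Sum>p\<le>j. lam (j + 1 - p) * ?U1 p x) + q x * ?U1 j x - lam 0 * ?U1 (j+1) x"
      unfolding l0 by (rule fd_rhs_eq[symmetric]) (use x W0 in \<open>auto simp: w0_left\<close>)
  qed auto
  moreover have "sol2 (1/2) 1 (?U2 (j+1)) d
        (\<lambda>x. - (\<Sum>p\<le>j. lam (j + 1 - p) * ?U2 p x) + q x * ?U2 j x - lam 0 * ?U2 (j+1) x)"
  proof (rule sol2_cong[OF sol2_split(2)[OF s, of "1/2"]])
    fix x :: real assume x: "x \<in> {1/2..1}"
    show "(H lam W j x - lam (Suc j) * w0 x) - \<omega>\<^sup>2 * W (Suc j) x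
      = - (\<Sum>p\<le>j. lam (j + 1 - p) * ?U2 p x) + q x * ?U2 j x - lam 0 * ?U2 (j+1) x"
      unfolding l0 by (rule fd_rhs_eq[symmetric]) (use x W0 in \<open>auto simp: w0_right\<close>)
  qed auto
  ultimately show "fd_step q lam ?U1 ?U2 j"
    unfolding fd_step_def Let_def using z by (intro exI[of _ d]) simp
qed (simp_all add: l0)

section \<open>Existence of the correction sequence\<close>

lemma H_absolutely_integrable:
  assumes "\<And>p. p \<le> j \<Longrightarrow> continuous_on {0..1} (W p)"
  shows "H lam W j absolutely_integrable_on {0..1}"
proof -
  have "(\<lambda>x. W j x * q x) absolutely_integrable_on {0..1}"
    by (intro absolutely_integrable_cont_mult q assms) simp
  moreover have "(\<lambda>x. \<Sum>p<j. lam (j - p) * W (Suc p) x) absolutely_integrable_on {0..1}"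
    by (intro absolutely_integrable_continuous_real continuous_intros assms) simp
  ultimately show ?thesis unfolding H_def [abs_def]
    by (subst mult.commute) (rule set_integral_diff(1))
qed

lemma fd_seq_exists: "\<exists>lam U1 U2. fd_seq q (\<omega>\<^sup>2) u01 u02 lam U1 U2"
proof -
  \<comment> \<open>Course-of-values recursion on pairs (eigenvalue correction, function
    correction), since \<open>H\<close> refers to all earlier pairs. Continuity is part of the
    invariant because it makes the next \<open>H\<close> integrable.\<close>
  define P where "P = (\<lambda>(f :: nat \<Rightarrow> real \<times> (real \<Rightarrow> real)) n r.
    continuous_on {0..1} (snd r) \<and>
    (case n of 0 \<Rightarrow> r = (\<omega>\<^sup>2, w0) | Suc j \<Rightarrow>
      (\<exists>d. sol2 0 1 (snd r) d (\<lambda>x. (H (\<lambda>i. fst (f i)) (\<lambda>i. snd (f i)) j x - fst r * w0 x) - \<omega>\<^sup>2 * snd r x) \<and>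
        d 0 = 0 \<and> snd r 0 = 0 \<and> snd r 1 = 0)))"
  have "\<exists>f. \<forall>n::nat. P f n (f n)"
  proof (rule dependent_wellorder_choice)
    fix r f g and n :: nat assume eq: "\<And>y. y < n \<Longrightarrow> f y = (g y :: real \<times> (real \<Rightarrow> real))"
    have "H (\<lambda>i. fst (f i)) (\<lambda>i. snd (f i)) j = H (\<lambda>i. fst (g i)) (\<lambda>i. snd (g i)) j" if "n = Suc j" for j
      using eq that unfolding H_def by (intro ext arg_cong2[where f = "(-)"] sum.cong) auto
    then show "P f n r = P g n r" by (auto simp: P_def split: nat.splits)
  next
    fix n :: nat and f assume IH: "\<And>y. y < n \<Longrightarrow> P f y (f y)"
    show "\<exists>r. P f n r"
    proof (cases n)
      case 0
      then show ?thesis by (auto simp: P_def w0_continuous)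
    next
      case (Suc j)
      define h where "h = H (\<lambda>i. fst (f i)) (\<lambda>i. snd (f i)) j"
      have h: "h absolutely_integrable_on {0..1}" unfolding h_def
        by (rule H_absolutely_integrable) (use IH Suc in \<open>auto simp: P_def\<close>)
      have w0i: "(\<lambda>x. c * w0 x) absolutely_integrable_on {0..1}" for c
        by (intro absolutely_integrable_continuous_real continuous_intros w0_continuous)
      \<comment> \<open>The unique value for which the integral of
        \<open>sin (\<omega> * (1 - t)) * F t\<close> vanishes, so that the solution with zero
        initial data also vanishes at 1.\<close>
      define l where "l = integral {0..1} (\<lambda>t. sin (\<omega> * (1 - t)) * h t) / D"
      define F where "F = (\<lambda>x. h x - l * w0 x)"
      have F: "F absolutely_integrable_on {0..1}" unfolding F_def by (intro set_integral_diff(1) h w0i)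
      define w where "w = (\<lambda>x. integral {0..x} (\<lambda>t. sin (\<omega> * (x - t)) * F t) / \<omega>)"
      obtain d where d: "sol2 0 1 w d (\<lambda>x. F x - \<omega>\<^sup>2 * w x)" "d 0 = 0"
        using Duhamel_sol2_oscillator[OF F, of \<omega>] \<omega> unfolding w_def by auto
      have "integral {0..1} (\<lambda>t. sin (\<omega> * (1 - t)) * F t)
        = integral {0..1} (\<lambda>t. sin (\<omega> * (1 - t)) * h t - l * (sin (\<omega> * (1 - t)) * w0 t))"
        by (rule integral_cong) (simp add: F_def algebra_simps)
      also have "\<dots> = integral {0..1} (\<lambda>t. sin (\<omega> * (1 - t)) * h t) - integral {0..1} (\<lambda>t. l * (sin (\<omega> * (1 - t)) * w0 t))"
        by (intro Henstock_Kurzweil_Integration.integral_diff set_lebesgue_integral_eq_integral(1)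
          absolutely_integrable_cont_mult h absolutely_integrable_continuous_real continuous_intros w0_continuous)
      also have "\<dots> = 0" using D_nonzero by (simp add: l_def D_def)
      finally have "w 1 = 0" by (simp add: w_def)
      moreover have "w 0 = 0" by (simp add: w_def)
      ultimately have "P f n (l, w)"
        using d sol2_continuous(1)[OF d(1)] Suc unfolding P_def F_def h_def by auto
      then show ?thesis by blast
    qed
  qed
  then obtain f where f: "\<And>n. P f n (f n)" by blast
  have "f 0 = (\<omega>\<^sup>2, w0)" using f[of 0] by (simp add: P_def)
  moreover have "\<exists>d. glued_step (\<lambda>i. fst (f i)) (\<lambda>i. snd (f i)) j d" for j
    using f[of "Suc j"] by (simp add: P_def glued_step_def)
  ultimately show ?thesis using fd_seq_of_glued[of "\<lambda>i. fst (f i)" "\<lambda>i. snd (f i)"] by auto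
qed

section \<open>Geometric decay of the corrections\<close>

definition \<kappa> :: real where "\<kappa> = 90 * L1norm q / \<omega>"

lemma abs_q_integrable: "(\<lambda>x. \<bar>q x\<bar>) integrable_on {0..1}"
  using q by (simp add: absolutely_integrable_on_def)

lemma L1norm_nonneg: "0 \<le> L1norm q"
  unfolding L1norm_def by (rule integral_nonneg[OF abs_q_integrable]) simp

lemma \<kappa>_nonneg: "0 \<le> \<kappa>"
  using L1norm_nonneg \<omega> by (simp add: \<kappa>_def)

lemma glued_continuous:
  assumes "W 0 = w0" "\<And>j. glued_step lam W j (d j)"
  shows "continuous_on {0..1} (W j)"
proof (cases j)
  case 0
  then show ?thesis using assms w0_continuous by simp
next
  case (Suc i)
  then show ?thesis using assms(2)[of i] sol2_continuous(1) unfolding glued_step_def by blast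
qed

lemma glued_estimates:
  assumes W0: "W 0 = w0" and st: "\<And>j. glued_step lam W j (d j)"
  shows "x \<in> {0..1} \<Longrightarrow> \<bar>W j x\<bar> \<le> b * \<kappa> ^ j" and "\<bar>lam (Suc j)\<bar> \<le> \<omega> * \<kappa> ^ Suc j"
proof -
  note cont = glued_continuous[OF W0 st]
  define Q where "Q = L1norm q"
  define l where "l = (\<lambda>j. \<bar>lam j\<bar>)"
  \<comment> \<open>Division by \<open>b\<close> makes \<open>N 0 \<le> 1\<close> and leaves a
    recursion in which the trial function is felt only through the ratio of \<open>b\<close> to
    |D|.\<close>
  define N where "N = (\<lambda>j. (SUP x\<in>{0..1}. \<bar>W j x\<bar>) / b)"
  define S where "S = (\<lambda>j. (\<Sum>p<j. l (j - p) * N (Suc p)) + Q * N j)"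
  have bdd: "bdd_above ((\<lambda>x. \<bar>W j x\<bar>) ` {0..1})" for j
    by (intro bounded_imp_bdd_above compact_imp_bounded compact_continuous_image continuous_intros cont) simp
  have WN: "\<bar>W j x\<bar> \<le> b * N j" if "x \<in> {0..1}" for j x
    using cSUP_upper[OF that bdd[of j]] b(1) by (simp add: N_def)
  have NW: "N j \<le> c" if "\<And>x. x \<in> {0..1} \<Longrightarrow> \<bar>W j x\<bar> \<le> b * c" for j c
  proof -
    have "(SUP x\<in>{0..1}. \<bar>W j x\<bar>) \<le> b * c" by (rule cSUP_least) (use that in auto)
    then show ?thesis using b(1) by (simp add: N_def divide_le_eq mult.commute)
  qed
  have N_nonneg: "0 \<le> N j" for j
  proof -
    have "0 \<le> b * N j" using WN[of 0 j] abs_ge_zero[of "W j 0"] by (simp del: abs_ge_zero)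
    then show ?thesis using b(1) by (simp add: zero_le_mult_iff)
  qed
  have l_nonneg: "0 \<le> l j" for j by (simp add: l_def)
  have Hi: "H lam W j absolutely_integrable_on {0..1}" for j
    by (rule H_absolutely_integrable) (rule cont)
  \<comment> \<open>A pointwise majorant of \<open>H\<close> with integral exactly
    \<open>b * S j\<close>: constant for the sum of earlier corrections, a multiple of |q| for the
    remaining term.\<close>
  define M where "M = (\<lambda>j x. b * (\<Sum>p<j. l (j - p) * N (Suc p)) + b * N j * \<bar>q x\<bar>)"
  have Mi: "M j integrable_on {0..1}" for j
    unfolding M_def by (intro integrable_add integrable_const_ivl integrable_on_mult_right abs_q_integrable)
  have HM: "\<bar>H lam W j x\<bar> \<le> M j x" if x: "x \<in> {0..1}" for j x
  proof -
    have "\<bar>\<Sum>p<j. lam (j - p) * W (Suc p) x\<bar> \<le> (\<Sum>p<j. l (j - p) * (b * N (Suc p)))"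
      using WN[OF x] unfolding l_def
      by (intro order_trans[OF sum_abs] sum_mono) (auto simp: abs_mult intro: mult_left_mono)
    also have "\<dots> = b * (\<Sum>p<j. l (j - p) * N (Suc p))"
      by (simp add: sum_distrib_left mult.left_commute)
    finally have 1: "\<bar>\<Sum>p<j. lam (j - p) * W (Suc p) x\<bar> \<le> b * (\<Sum>p<j. l (j - p) * N (Suc p))" .
    have "\<bar>q x * W j x\<bar> \<le> b * N j * \<bar>q x\<bar>"
      using mult_right_mono[OF WN[OF x, of j], of "\<bar>q x\<bar>"] by (simp add: abs_mult mult.commute)
    with 1 show ?thesis unfolding H_def M_def by linarith
  qed
  have Mint: "integral {0..1} (M j) = b * S j" for j
  proof -
    have "integral {0..1} (M j) = b * (\<Sum>p<j. l (j - p) * N (Suc p)) + b * N j * Q"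
      unfolding M_def Q_def L1norm_def
      by (subst Henstock_Kurzweil_Integration.integral_add)
        (auto intro!: integrable_on_mult_right abs_q_integrable)
    then show ?thesis by (simp add: S_def algebra_simps)
  qed
  have Hint: "\<bar>integral {0..1} (\<lambda>t. sin (\<omega> * (1 - t)) * H lam W j t)\<bar> \<le> b * S j" for j
    unfolding Mint[symmetric]
  proof (rule integral_abs_bound_real)
    show "(\<lambda>t. sin (\<omega> * (1 - t)) * H lam W j t) integrable_on {0..1}"
      by (intro set_lebesgue_integral_eq_integral(1) absolutely_integrable_cont_mult Hi continuous_intros)
    fix x :: real assume x: "x \<in> {0..1}"
    have "\<bar>sin (\<omega> * (1 - x)) * H lam W j x\<bar> \<le> 1 * \<bar>H lam W j x\<bar>"
      unfolding abs_mult by (rule mult_right_mono) auto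
    then show "\<bar>sin (\<omega> * (1 - x)) * H lam W j x\<bar> \<le> M j x" using HM[OF x, of j] by simp
  qed (rule Mi)
  define F where "F = (\<lambda>j x. H lam W j x - lam (Suc j) * w0 x)"
  have Fi: "F j absolutely_integrable_on {0..1}" for j unfolding F_def
    by (intro set_integral_diff(1) Hi absolutely_integrable_continuous_real continuous_intros w0_continuous)
  have Duh: "\<omega> * W (Suc j) x = integral {0..x} (\<lambda>t. sin (\<omega> * (x - t)) * F j t)" if "x \<in> {0..1}" for j x
    by (rule sol2_oscillator_eq_Duhamel[OF _ Fi _ _ that, where d = "d j"])
      (use st[of j] in \<open>auto simp: glued_step_def F_def\<close>)
  \<comment> \<open>At x = 1 the variation-of-constants formula has left side 0, which expresses
    \<open>lam (Suc j) * D\<close> by \<open>H\<close> alone; |sin| \<le> 1 and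
    \<open>b_le_D\<close> then give the factor 4.\<close>
  have lS: "l (Suc j) \<le> 4 * S j" for j
  proof -
    have "0 = integral {0..1} (\<lambda>t. sin (\<omega> * (1 - t)) * F j t)"
      using Duh[of 1 j] st[of j] by (simp add: glued_step_def)
    also have "\<dots> = integral {0..1} (\<lambda>t. sin (\<omega> * (1 - t)) * H lam W j t - lam (Suc j) * (sin (\<omega> * (1 - t)) * w0 t))"
      by (rule integral_cong) (simp add: F_def algebra_simps)
    also have "\<dots> = integral {0..1} (\<lambda>t. sin (\<omega> * (1 - t)) * H lam W j t)
        - integral {0..1} (\<lambda>t. lam (Suc j) * (sin (\<omega> * (1 - t)) * w0 t))"
      by (intro Henstock_Kurzweil_Integration.integral_diff set_lebesgue_integral_eq_integral(1)
          absolutely_integrable_cont_mult Hi absolutely_integrable_continuous_real continuous_intros w0_continuous)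
    finally have "lam (Suc j) * D = integral {0..1} (\<lambda>t. sin (\<omega> * (1 - t)) * H lam W j t)"
      by (simp add: D_def)
    then have "l (Suc j) * \<bar>D\<bar> \<le> b * S j" using Hint[of j] by (simp add: l_def abs_mult[symmetric])
    moreover have "b * l (Suc j) \<le> (4 * \<bar>D\<bar>) * l (Suc j)" by (rule mult_right_mono[OF b_le_D l_nonneg])
    ultimately have "b * l (Suc j) \<le> b * (4 * S j)" by (simp add: mult_ac)
    then show ?thesis using b(1) by simp
  qed
  \<comment> \<open>5 = 1 + 4: one \<open>S j\<close> from \<open>H\<close>, four from the term
    \<open>lam (Suc j) * w0\<close>, estimated by the previous bound.\<close>
  have NS: "\<omega> * N (Suc j) \<le> 5 * S j" for j
  proof -
    have "\<bar>W (Suc j) x\<bar> \<le> b * (5 * S j / \<omega>)" if x: "x \<in> {0..1}" for x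
    proof -
      have Fi': "(\<lambda>t. sin (\<omega> * (x - t)) * F j t) absolutely_integrable_on {0..1}"
        by (intro absolutely_integrable_cont_mult Fi continuous_intros)
      have Mi': "(\<lambda>t. M j t + l (Suc j) * b) integrable_on {0..1}"
        by (intro integrable_add Mi integrable_const_ivl)
      have pw: "\<bar>sin (\<omega> * (x - t)) * F j t\<bar> \<le> M j t + l (Suc j) * b" if t: "t \<in> {0..1}" for t
      proof -
        have "\<bar>sin (\<omega> * (x - t)) * F j t\<bar> \<le> 1 * \<bar>F j t\<bar>"
          unfolding abs_mult by (rule mult_right_mono) auto
        moreover have "\<bar>F j t\<bar> \<le> \<bar>H lam W j t\<bar> + \<bar>lam (Suc j) * w0 t\<bar>"
          unfolding F_def by (rule abs_triangle_ineq4)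
        moreover have "\<bar>lam (Suc j) * w0 t\<bar> \<le> l (Suc j) * b"
          unfolding abs_mult l_def using w0_bound[OF t] by (intro mult_left_mono) auto
        ultimately show ?thesis using HM[OF t, of j] by linarith
      qed
      have "\<bar>integral {0..x} (\<lambda>t. sin (\<omega> * (x - t)) * F j t)\<bar> \<le> integral {0..x} (\<lambda>t. M j t + l (Suc j) * b)"
      proof (rule integral_abs_bound_real)
        show "(\<lambda>t. sin (\<omega> * (x - t)) * F j t) integrable_on {0..x}"
          using absolutely_integrable_on_subinterval[OF Fi', of 0 x] x
          by (auto simp: absolutely_integrable_on_def)
        show "(\<lambda>t. M j t + l (Suc j) * b) integrable_on {0..x}"
          using integrable_on_subinterval[OF Mi', of 0 x] x by auto
      qed (use pw x in auto)
      also have "\<dots> \<le> integral {0..1} (\<lambda>t. M j t + l (Suc j) * b)"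
      proof (rule integral_subset_le)
        show "(\<lambda>t. M j t + l (Suc j) * b) integrable_on {0..x}"
          using integrable_on_subinterval[OF Mi', of 0 x] x by auto
        show "\<forall>t\<in>{0..1}. 0 \<le> M j t + l (Suc j) * b"
          using pw by (meson abs_ge_zero order_trans)
      qed (use x Mi' in auto)
      also have "\<dots> = b * S j + l (Suc j) * b"
        by (subst Henstock_Kurzweil_Integration.integral_add) (simp_all add: Mi Mint integrable_const_ivl)
      also have "\<dots> \<le> b * S j + 4 * S j * b"
        using lS[of j] b(1) by (intro add_left_mono mult_right_mono) auto
      finally have "\<omega> * \<bar>W (Suc j) x\<bar> \<le> b * (5 * S j)"
        unfolding Duh[OF x, symmetric] using \<omega> by (simp add: abs_mult algebra_simps)
      then show ?thesis using \<omega> by (simp add: field_simps)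
    qed
    then have "N (Suc j) \<le> 5 * S j / \<omega>" by (rule NW)
    then show ?thesis using \<omega> by (simp add: field_simps)
  qed
  have "N 0 \<le> 1" by (rule NW) (use W0 w0_bound in auto)
  note res = quadratic_recursion_geometric_limit[of \<omega> Q l N, OF \<omega> _ l_nonneg N_nonneg this lS[unfolded S_def] NS[unfolded S_def]]
  have Q0: "0 \<le> Q" using L1norm_nonneg by (simp add: Q_def)
  have "N j \<le> \<kappa> ^ j" using res(1)[OF Q0] by (simp add: \<kappa>_def Q_def)
  then show "\<bar>W j x\<bar> \<le> b * \<kappa> ^ j" if "x \<in> {0..1}"
    using WN[OF that, of j] b(1) mult_left_mono[of "N j" "\<kappa> ^ j" b] by linarith
  show "\<bar>lam (Suc j)\<bar> \<le> \<omega> * \<kappa> ^ Suc j" using res(2)[OF Q0] by (simp add: \<kappa>_def Q_def l_def)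
qed

section \<open>Convergence to an eigensolution\<close>

lemma fd_seq_converges:
  assumes fd: "fd_seq q (\<omega>\<^sup>2) u01 u02 lam U1 U2" and \<kappa>1: "\<kappa> < 1"
  shows "\<exists>Lam u. lam sums Lam \<and> (\<forall>x\<in>{0..1/2}. (\<lambda>j. U1 j x) sums u x) \<and>
    (\<forall>x\<in>{1/2..1}. (\<lambda>j. U2 j x) sums u x) \<and> eig_sol q Lam u u \<and>
    (\<forall>m. (\<forall>x\<in>{0..1/2}. \<bar>u x - (\<Sum>j\<le>m. U1 j x)\<bar> \<le> b * (\<kappa> ^ (m + 1) / (1 - \<kappa>))) \<and>
         (\<forall>x\<in>{1/2..1}. \<bar>u x - (\<Sum>j\<le>m. U2 j x)\<bar> \<le> b * (\<kappa> ^ (m + 1) / (1 - \<kappa>))) \<and>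
         \<bar>Lam - (\<Sum>j\<le>m. lam j)\<bar> \<le> \<omega> * (\<kappa> ^ (m + 1) / (1 - \<kappa>)))"
proof -
  define W where "W = (\<lambda>j. glue (U1 j) (U2 j))"
  have W0: "W 0 = w0" unfolding W_def by (rule glue_fd_seq(1)[OF fd])
  have "\<exists>d. glued_step lam W j d" for j unfolding W_def by (rule glue_fd_seq(2)[OF fd])
  then obtain d where st: "\<And>j. glued_step lam W j (d j)" by metis
  have L: "U1 j x = W j x" if "x \<in> {0..1/2}" for j x unfolding W_def by (rule glue_fd_seq(3)[OF fd that])
  have R: "U2 j x = W j x" if "x \<in> {1/2..1}" for j x unfolding W_def by (rule glue_fd_seq(4)[OF fd that])
  have lam0: "lam 0 = \<omega>\<^sup>2" using fd by (simp add: fd_seq_def)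
  note Wb = glued_estimates(1)[OF W0 st] and lamb = glued_estimates(2)[OF W0 st]
  \<comment> \<open>The first summand covers \<lambda>_0, the second the bound for all later
    indices.\<close>
  define K where "K = \<omega>\<^sup>2 + \<omega>"
  have K0: "0 \<le> K" using \<omega> by (simp add: K_def)
  have lamK: "\<bar>lam j\<bar> \<le> K * \<kappa> ^ j" for j
  proof (cases j)
    case 0
    then show ?thesis using lam0 \<omega> by (simp add: K_def)
  next
    case (Suc i)
    have "\<omega> * \<kappa> ^ j \<le> K * \<kappa> ^ j" using \<kappa>_nonneg by (intro mult_right_mono) (auto simp: K_def)
    then show ?thesis using lamb[of i] Suc by simp
  qed
  have geo: "summable (\<lambda>j. \<kappa> ^ j)" using \<kappa>_nonneg \<kappa>1 by (intro summable_geometric) simp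
  have slam: "summable (\<lambda>j. \<bar>lam j\<bar>)"
    by (rule summable_comparison_test[OF _ summable_mult[OF geo, of K]]) (use lamK in auto)
  have sW: "summable (\<lambda>j. \<bar>W j x\<bar>)" if "x \<in> {0..1}" for x
    by (rule summable_comparison_test[OF _ summable_mult[OF geo, of b]]) (use Wb[OF that] in auto)
  define Lam where "Lam = suminf lam"
  define u where "u = (\<lambda>x. \<Sum>j. W j x)"
  have lam_sums: "lam sums Lam" unfolding Lam_def by (rule summable_sums[OF summable_rabs_cancel[OF slam]])
  have u_sums: "(\<lambda>j. W j x) sums u x" if "x \<in> {0..1}" for x
    unfolding u_def by (rule summable_sums[OF summable_rabs_cancel[OF sW[OF that]]])
  \<comment> \<open>\<open>W j\<close> is driven by \<open>q * W (j - 1)\<close>; the shift with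
    default 0 makes \<open>g j\<close> the full right-hand side for every j, including the trial
    function at j = 0. The shift does not change the sum, and the convolution sums to the product of
    the eigenvalue series and the function series, so the \<open>g j\<close> add up to
    \<open>(q x - Lam) * u x\<close>.\<close>
  define c where "c = (\<lambda>j x. case j of 0 \<Rightarrow> 0 | Suc i \<Rightarrow> q x * W i x)"
  define g where "g = (\<lambda>j x. c j x - (\<Sum>p\<le>j. W p x * lam (j - p)))"
  \<comment> \<open>The factor \<open>Suc j\<close> counts the terms of the convolution, each at
    most \<open>b * K * \<kappa> ^ j\<close>; the second summand bounds the shifted term with
    \<open>q\<close>.\<close>
  define A where "A = (\<lambda>j. b * K * (real (Suc j) * \<kappa> ^ j) + b * (case j of 0 \<Rightarrow> 0 | Suc i \<Rightarrow> \<kappa> ^ i))"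
  define h where "h = (\<lambda>x. 1 + \<bar>q x\<bar>)"
  have hi: "h integrable_on {0..1}"
    unfolding h_def by (intro integrable_add integrable_const_ivl abs_q_integrable)
  have h1: "1 \<le> h x" "\<bar>q x\<bar> \<le> h x" "0 \<le> h x" for x by (auto simp: h_def)
  have sA: "summable A"
  proof -
    have "summable (\<lambda>j. real (Suc j) * \<kappa> ^ j)"
      using geometric_deriv_sums[of \<kappa>] \<kappa>_nonneg \<kappa>1 by (auto simp: sums_iff)
    moreover have "summable (\<lambda>j. case j of 0 \<Rightarrow> 0 | Suc i \<Rightarrow> \<kappa> ^ i)"
      using geo by (subst summable_Suc_iff[symmetric]) simp
    ultimately show ?thesis unfolding A_def by (intro summable_add summable_mult)
  qed
  have A0: "0 \<le> A j" for j
    unfolding A_def using b(1) K0 \<kappa>_nonneg by (cases j) auto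
  have gA: "\<bar>g j x\<bar> \<le> A j * h x" if x: "x \<in> {0..1}" for j x
  proof -
    have "\<bar>\<Sum>p\<le>j. W p x * lam (j - p)\<bar> \<le> (\<Sum>p\<le>j. b * K * \<kappa> ^ j)"
    proof (rule order_trans[OF sum_abs sum_mono])
      fix p assume "p \<in> {..j}"
      then have "\<kappa> ^ j = \<kappa> ^ p * \<kappa> ^ (j - p)" by (simp add: power_add[symmetric])
      moreover have "\<bar>W p x\<bar> * \<bar>lam (j - p)\<bar> \<le> (b * \<kappa> ^ p) * (K * \<kappa> ^ (j - p))"
        by (rule mult_mono[OF Wb[OF x] lamK]) (use b(1) \<kappa>_nonneg in auto)
      ultimately show "\<bar>W p x * lam (j - p)\<bar> \<le> b * K * \<kappa> ^ j" by (simp add: abs_mult mult_ac)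
    qed
    also have "\<dots> = b * K * (real (Suc j) * \<kappa> ^ j)" by (simp add: algebra_simps)
    also have "\<dots> \<le> b * K * (real (Suc j) * \<kappa> ^ j) * h x"
      using mult_left_mono[OF h1(1)[of x], of "b * K * (real (Suc j) * \<kappa> ^ j)"] b(1) K0 \<kappa>_nonneg by simp
    finally have 1: "\<bar>\<Sum>p\<le>j. W p x * lam (j - p)\<bar> \<le> b * K * (real (Suc j) * \<kappa> ^ j) * h x" .
    have 2: "\<bar>c j x\<bar> \<le> b * (case j of 0 \<Rightarrow> 0 | Suc i \<Rightarrow> \<kappa> ^ i) * h x"
    proof (cases j)
      case 0
      then show ?thesis by (simp add: c_def)
    next
      case (Suc i)
      have "\<bar>W i x\<bar> * \<bar>q x\<bar> \<le> (b * \<kappa> ^ i) * h x"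
        by (rule mult_mono[OF Wb[OF x] h1(2)]) (use b(1) \<kappa>_nonneg in auto)
      then show ?thesis using Suc by (simp add: c_def abs_mult mult.commute)
    qed
    have "\<bar>g j x\<bar> \<le> \<bar>c j x\<bar> + \<bar>\<Sum>p\<le>j. W p x * lam (j - p)\<bar>"
      unfolding g_def by (rule abs_triangle_ineq4)
    then show ?thesis using 1 2 unfolding A_def distrib_right by linarith
  qed
  have g_sums: "(\<lambda>j. g j x) sums ((q x - Lam) * u x)" if x: "x \<in> {0..1}" for x
  proof -
    have "(\<lambda>j. q x * W j x) sums (q x * u x)" by (rule sums_mult[OF u_sums[OF x]])
    then have "(\<lambda>j. c (Suc j) x) sums (q x * u x - c 0 x)" by (simp add: c_def)
    then have "(\<lambda>j. c j x) sums (q x * u x)" by (subst (asm) sums_Suc_iff) simp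
    moreover have "(\<lambda>j. \<Sum>p\<le>j. W p x * lam (j - p)) sums (u x * Lam)"
      unfolding u_def Lam_def by (rule Cauchy_product_sums) (use sW[OF x] slam in auto)
    ultimately have "(\<lambda>j. g j x) sums (q x * u x - u x * Lam)" unfolding g_def by (rule sums_diff)
    then show ?thesis by (simp add: algebra_simps)
  qed
  have g_Suc: "(H lam W j x - lam (Suc j) * w0 x) - \<omega>\<^sup>2 * W (Suc j) x = g (Suc j) x" for j x
  proof -
    have "(\<Sum>p\<le>Suc j. W p x * lam (Suc j - p))
        = (\<Sum>p\<le>j. W p x * lam (Suc j - p)) + W (Suc j) x * lam 0" by simp
    also have "(\<Sum>p\<le>j. W p x * lam (Suc j - p)) = W 0 x * lam (Suc j) + (\<Sum>p<j. W (Suc p) x * lam (j - p))"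
      unfolding lessThan_Suc_atMost[symmetric] sum.lessThan_Suc_shift by simp
    finally show ?thesis by (simp add: g_def c_def H_def W0 lam0 mult.commute)
  qed
  have g_0: "- (\<omega>\<^sup>2 * w0 x) = g 0 x" for x by (simp add: g_def c_def W0 lam0)
  \<comment> \<open>A correction has one derivative on both halves. Only the trial function has two,
    which differ by 1 at 1/2, so index 0 alone produces the derivative jump of the sum.\<close>
  define e1 where "e1 = (\<lambda>j. case j of 0 \<Rightarrow> d01 | Suc i \<Rightarrow> d i)"
  define e2 where "e2 = (\<lambda>j. case j of 0 \<Rightarrow> d02 | Suc i \<Rightarrow> d i)"
  have stS: "sol2 0 1 (W (Suc i)) (d i) (g (Suc i))" for i
    using st[of i] unfolding glued_step_def g_Suc by simp
  have s1: "sol2 0 (1/2) (W j) (e1 j) (g j)" for j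
  proof (cases j)
    case 0
    show ?thesis unfolding 0
      by (rule sol2_cong[OF s01]) (simp_all add: W0 w0_left e1_def g_0[symmetric])
  next
    case (Suc i)
    show ?thesis unfolding Suc e1_def using sol2_split(1)[OF stS[of i], of "1/2"] by simp
  qed
  have s2: "sol2 (1/2) 1 (W j) (e2 j) (g j)" for j
  proof (cases j)
    case 0
    show ?thesis unfolding 0
      by (rule sol2_cong[OF s02]) (simp_all add: W0 w0_right e2_def g_0[symmetric])
  next
    case (Suc i)
    show ?thesis unfolding Suc e2_def using sol2_split(2)[OF stS[of i], of "1/2"] by simp
  qed
  have hi1: "h integrable_on {0..1/2}" and hi2: "h integrable_on {1/2..1}"
    using integrable_on_subinterval[OF hi] by auto
  have e1_0: "e1 j 0 = (if j = 0 then 1 else 0)" for j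
    using st bc(3) by (cases j) (auto simp: e1_def glued_step_def)
  have e_mid: "e2 j (1/2) = e1 j (1/2) + (if j = 0 then 1 else 0)" for j
    using jump(2) by (cases j) (auto simp: e1_def e2_def)
  have one_sums: "(\<lambda>j. if j = 0 then 1 else 0 :: real) sums 1"
    using sums_single[of 0 "\<lambda>_. 1::real"] by simp
  have W_at: "summable (\<lambda>j. W j x)" if "x \<in> {0..1}" for x
    by (rule summable_rabs_cancel[OF sW[OF that]])
  have e10: "summable (\<lambda>j. \<bar>e1 j 0\<bar>)" using one_sums by (simp add: e1_0 sums_iff cong: if_cong)
  have gA1: "\<bar>g j x\<bar> \<le> A j * h x" if "x \<in> {0..1/2}" for j x using gA[of x j] that by simp
  have gA2: "\<bar>g j x\<bar> \<le> A j * h x" if "x \<in> {1/2..1}" for j x using gA[of x j] that by simp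
  note L1 = sol2_suminf[OF s1 _ hi1 h1(3) sA A0 gA1 e10 W_at, simplified]
  \<comment> \<open>Summation on the left half delivers absolute summability of the derivatives at
    1/2, which is the initial datum needed on the right half.\<close>
  have e1m: "summable (\<lambda>j. \<bar>e1 j (1/2)\<bar>)" by (rule L1(2)) auto
  have e2m: "summable (\<lambda>j. \<bar>e2 j (1/2)\<bar>)"
    by (rule summable_comparison_test[OF _ summable_add[OF e1m sums_summable[OF one_sums]]]) (auto simp: e_mid)
  note L2 = sol2_suminf[OF s2 _ hi2 h1(3) sA A0 gA2 e2m W_at, simplified]
  have "eig_sol q Lam u u"
    unfolding eig_sol_def
  proof (intro exI conjI)
    show "sol2 0 (1/2) u (\<lambda>x. \<Sum>j. e1 j x) (\<lambda>x. (q x - Lam) * u x)"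
      by (rule sol2_cong[OF L1(1)]) (use g_sums in \<open>auto simp: u_def sums_iff\<close>)
    show "sol2 (1/2) 1 u (\<lambda>x. \<Sum>j. e2 j x) (\<lambda>x. (q x - Lam) * u x)"
      by (rule sol2_cong[OF L2(1)]) (use g_sums in \<open>auto simp: u_def sums_iff\<close>)
    have "W j 0 = 0" "W j 1 = 0" for j
      using st bc w0_left[of 0] w0_right[of 1] W0 by (cases j; simp add: glued_step_def)+
    then show "u 0 = 0" "u 1 = 0" by (simp_all add: u_def)
    show "(\<Sum>j. e1 j 0) = 1" unfolding e1_0 by (rule sums_unique[OF one_sums, symmetric])
    show "u (1/2) - u (1/2) = 0" by simp
    show "(\<Sum>j. e2 j (1/2)) - (\<Sum>j. e1 j (1/2)) = 1"
      using sums_add[OF summable_sums[OF summable_rabs_cancel[OF e1m]] one_sums]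
      by (simp add: e_mid sums_iff)
  qed
  moreover have tail_u: "\<bar>u x - (\<Sum>j\<le>m. W j x)\<bar> \<le> b * (\<kappa> ^ (m + 1) / (1 - \<kappa>))" if "x \<in> {0..1}" for x m
    unfolding u_def by (rule suminf_minus_atMost_le_geometric[OF Wb[OF that] \<kappa>_nonneg \<kappa>1 W_at[OF that]])
  moreover have "\<bar>Lam - (\<Sum>j\<le>m. lam j)\<bar> \<le> \<omega> * (\<kappa> ^ (m + 1) / (1 - \<kappa>))" for m
    unfolding Lam_def
  proof (rule suminf_minus_atMost_le_geometric[OF _ \<kappa>_nonneg \<kappa>1 summable_rabs_cancel[OF slam]])
    \<comment> \<open>Here j \<ge> 1, so the bound for the eigenvalue corrections applies.\<close>
    fix j assume "j > m"
    then show "\<bar>lam j\<bar> \<le> \<omega> * \<kappa> ^ j" using lamb[of "j - 1"] by simp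
  qed
  ultimately show ?thesis
    using lam_sums u_sums by (intro exI[of _ Lam] exI[of _ u]) (simp add: L R)
qed

section \<open>Error bounds at the claimed rate\<close>

lemma fd_seq_error_bounds:
  assumes fd: "fd_seq q (\<omega>\<^sup>2) u01 u02 lam U1 U2"
    and r: "2 * ((11/3) * L1norm q * (1 + 16/3 + 2 * sqrt (88/9))) / \<omega> \<le> r" "r < 1"
    and r0: "L1norm q = 0 \<Longrightarrow> r = 0" and A: "A > 0"
  shows "\<exists>Lam u. lam sums Lam \<and> (\<forall>x\<in>{0..1/2}. (\<lambda>j. U1 j x) sums u x) \<and>
    (\<forall>x\<in>{1/2..1}. (\<lambda>j. U2 j x) sums u x) \<and> eig_sol q Lam u u \<and>
    (\<exists>c>0. \<exists>\<epsilon>>0. \<forall>m::nat. 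
       (\<forall>x\<in>{0..1/2}. \<bar>u x - (\<Sum>j\<le>m. U1 j x)\<bar> \<le> A * (c / (1 - r)) / real (m+1) powr (1+\<epsilon>) * r^(m+1)) \<and>
       (\<forall>x\<in>{1/2..1}. \<bar>u x - (\<Sum>j\<le>m. U2 j x)\<bar> \<le> A * (c / (1 - r)) / real (m+1) powr (1+\<epsilon>) * r^(m+1)) \<and>
       \<bar>Lam - (\<Sum>j\<le>m. lam j)\<bar> \<le> (c / (1 - r)) / (real (m+1) powr (1+\<epsilon>) * Rconst q) * r^m)"
proof -
  \<comment> \<open>The left side is about 46.15. Twice 45 is the constant in
    \<open>\<kappa>\<close>, so the claimed rate exceeds \<open>\<kappa>\<close> strictly as soon as
    the norm of \<open>q\<close> is positive.\<close>
  have X: "(11/3) * (1 + 16/3 + 2 * sqrt (88/9)) > (45::real)"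
  proof -
    have "3.1 \<le> sqrt (88/9 :: real)" by (rule real_le_rsqrt) (simp add: power2_eq_square)
    then show ?thesis by simp
  qed
  have \<kappa>r: "\<kappa> < r \<or> \<kappa> = 0 \<and> r = 0"
  proof (cases "L1norm q = 0")
    case True
    then show ?thesis using r0 by (simp add: \<kappa>_def)
  next
    case False
    then have "L1norm q > 0" using L1norm_nonneg by simp
    then have "45 * L1norm q < (11/3) * (1 + 16/3 + 2 * sqrt (88/9)) * L1norm q"
      using X by (intro mult_strict_right_mono)
    then have "\<kappa> < 2 * ((11/3) * L1norm q * (1 + 16/3 + 2 * sqrt (88/9))) / \<omega>"
      unfolding \<kappa>_def using \<omega> by (intro divide_strict_right_mono) (simp_all add: algebra_simps)
    then show ?thesis using r(1) by simp
  qed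
  have R: "Rconst q > 0 \<or> Rconst q = 0 \<and> \<kappa> = 0"
  proof (cases "L1norm q = 0")
    case False
    then have "L1norm q > 0" using L1norm_nonneg by simp
    moreover have "0 < 1 + 16/3 + 2 * sqrt (88/9 :: real)" by (simp add: add_pos_nonneg)
    ultimately show ?thesis unfolding Rconst_def by simp
  qed (simp add: Rconst_def \<kappa>_def)
  have r_nonneg: "0 \<le> r" using \<kappa>r \<kappa>_nonneg by auto
  have \<kappa>1: "\<kappa> < 1" using \<kappa>r r(2) by auto
  obtain G where G: "G > 0" "\<And>m. \<kappa> ^ (m + 1) / (1 - \<kappa>) \<le> G / real (m + 1) powr (1 + 1) * r ^ (m + 1)"
    using geometric_tail_le[OF \<kappa>_nonneg \<kappa>r r(2)] by blast
  \<comment> \<open>The first summand serves the functions, turning the bound \<open>b\<close> into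
    the prescribed prefactor \<open>A\<close>; the second serves the eigenvalue, turning \<omega>
    into \<open>1 / Rconst q\<close>. Defining \<open>c\<close> through \<open>C\<close> cancels the
    factor 1 / (1 - r).\<close>
  define C where "C = (b / A + \<omega> * Rconst q) * G"
  define c where "c = C * (1 - r)"
  have bA: "0 < b / A" using b(1) A by simp
  have "C > 0" unfolding C_def using bA \<omega> R G(1) by (intro mult_pos_pos add_pos_nonneg) auto
  then have c: "c > 0" "c / (1 - r) = C" using r(2) by (auto simp: c_def)
  have Au: "b * (\<kappa> ^ (m + 1) / (1 - \<kappa>)) \<le> A * C / real (m + 1) powr (1 + 1) * r ^ (m + 1)" for m
  proof -
    have "b * G \<le> A * C"
    proof -
      have "A * C = b * G + A * \<omega> * Rconst q * G" using A by (simp add: C_def field_simps)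
      moreover have "0 \<le> A * \<omega> * Rconst q * G" using A \<omega> R G(1) by auto
      ultimately show ?thesis by simp
    qed
    then have "b * G * (r ^ (m + 1) / real (m + 1) powr (1 + 1)) \<le> A * C * (r ^ (m + 1) / real (m + 1) powr (1 + 1))"
      using r_nonneg by (intro mult_right_mono) auto
    moreover have "b * (\<kappa> ^ (m + 1) / (1 - \<kappa>)) \<le> b * (G / real (m + 1) powr (1 + 1) * r ^ (m + 1))"
      using G(2)[of m] b(1) by (intro mult_left_mono) auto
    ultimately show ?thesis by simp
  qed
  have Alam: "\<omega> * (\<kappa> ^ (m + 1) / (1 - \<kappa>)) \<le> C / (real (m + 1) powr (1 + 1) * Rconst q) * r ^ m" for m
    using R
  proof
    assume R: "Rconst q > 0"
    have "0 \<le> b / A * G" using mult_pos_pos[OF bA G(1)] by linarith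
    then have "\<omega> * Rconst q * G \<le> C" unfolding C_def distrib_right by linarith
    then have 1: "\<omega> * G \<le> C / Rconst q" using R by (simp add: field_simps)
    have "\<omega> * (\<kappa> ^ (m + 1) / (1 - \<kappa>)) \<le> \<omega> * (G / real (m + 1) powr (1 + 1) * r ^ (m + 1))"
      using G(2)[of m] \<omega> by (intro mult_left_mono) auto
    also have "\<dots> = \<omega> * G * (r ^ (m + 1) / real (m + 1) powr (1 + 1))" by simp
    also have "\<dots> \<le> C / Rconst q * (r ^ m / real (m + 1) powr (1 + 1))"
    proof (rule mult_mono[OF 1 divide_right_mono])
      show "r ^ (m + 1) \<le> r ^ m" using r_nonneg r(2) by (intro power_decreasing) auto
    qed (use \<open>C > 0\<close> R r_nonneg in auto)
    also have "\<dots> = C / (real (m + 1) powr (1 + 1) * Rconst q) * r ^ m" by simp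
    finally show ?thesis .
  next
    \<comment> \<open>Division by zero makes the right side 0, and so is the left side, as the
      exponent m + 1 is positive.\<close>
    assume "Rconst q = 0 \<and> \<kappa> = 0"
    then show ?thesis by simp
  qed
  from fd_seq_converges[OF fd \<kappa>1] obtain Lam u where
    conv: "lam sums Lam" "\<forall>x\<in>{0..1/2}. (\<lambda>j. U1 j x) sums u x" "\<forall>x\<in>{1/2..1}. (\<lambda>j. U2 j x) sums u x"
      "eig_sol q Lam u u" and
    tail: "\<And>m x. x \<in> {0..1/2} \<Longrightarrow> \<bar>u x - (\<Sum>j\<le>m. U1 j x)\<bar> \<le> b * (\<kappa> ^ (m + 1) / (1 - \<kappa>))"
      "\<And>m x. x \<in> {1/2..1} \<Longrightarrow> \<bar>u x - (\<Sum>j\<le>m. U2 j x)\<bar> \<le> b * (\<kappa> ^ (m + 1) / (1 - \<kappa>))"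
      "\<And>m. \<bar>Lam - (\<Sum>j\<le>m. lam j)\<bar> \<le> \<omega> * (\<kappa> ^ (m + 1) / (1 - \<kappa>))"
    by blast
  have "\<exists>c>0. \<exists>\<epsilon>>0. \<forall>m::nat. 
       (\<forall>x\<in>{0..1/2}. \<bar>u x - (\<Sum>j\<le>m. U1 j x)\<bar> \<le> A * (c / (1 - r)) / real (m+1) powr (1+\<epsilon>) * r^(m+1)) \<and>
       (\<forall>x\<in>{1/2..1}. \<bar>u x - (\<Sum>j\<le>m. U2 j x)\<bar> \<le> A * (c / (1 - r)) / real (m+1) powr (1+\<epsilon>) * r^(m+1)) \<and>
       \<bar>Lam - (\<Sum>j\<le>m. lam j)\<bar> \<le> (c / (1 - r)) / (real (m+1) powr (1+\<epsilon>) * Rconst q) * r^m"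
    by (rule exI[of _ c], rule conjI[OF c(1)], rule exI[of _ 1], rule conjI[OF zero_less_one], unfold c(2),
        intro allI conjI ballI order_trans[OF tail(1) Au] order_trans[OF tail(2) Au] order_trans[OF tail(3) Alam])
  with conv show ?thesis by blast
qed

end

section \<open>The two families of trial solutions\<close>

lemma has_integral_of_derivative:
  fixes f \<Phi> :: "real \<Rightarrow> real"
  assumes "\<And>x. (\<Phi> has_real_derivative f x) (at x)" "a \<le> b"
  shows "(f has_integral (\<Phi> b - \<Phi> a)) {a..b}"
proof (rule fundamental_theorem_of_calculus[OF assms(2)])
  show "(\<Phi> has_vector_derivative f x) (at x within {a..b})" for x
    unfolding has_real_derivative_iff_has_vector_derivative[symmetric]
    by (rule has_field_derivative_at_within[OF assms(1)])
qed

lemmas integral_of_derivative = integral_unique[OF has_integral_of_derivative]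

lemma sol2_of_derivatives:
  assumes "\<And>x. (u has_real_derivative d x) (at x)" "\<And>x. (d has_real_derivative g x) (at x)" "a \<le> b"
  shows "sol2 a b u d g"
proof -
  have hi: "(g has_integral (d x - d a)) {a..x}" if "a \<le> x" for x
    by (rule has_integral_of_derivative[OF assms(2) that])
  show ?thesis
    unfolding sol2_def
  proof (intro conjI ballI)
    show "g integrable_on {a..b}" using hi[OF assms(3)] by (rule has_integral_integrable)
    fix x assume "x \<in> {a..b}"
    then have "a \<le> x" by simp
    show "(u has_real_derivative d x) (at x within {a..b})"
      by (rule has_field_derivative_at_within[OF assms(1)])
    show "d x = d a + integral {a..x} g" using integral_unique[OF hi[OF \<open>a \<le> x\<close>]] by simp
  qed
qed

text \<open>The choice of \<open>l0\<close> makes cos (\<omega> / 2) = -1/2, which is exactly a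
  derivative jump of -2 cos (\<omega> / 2) = 1, and it forces cos \<omega> = -1/2. In the sum of the
  two integrals the terms with sin \<omega> cancel, leaving (1 - cos \<omega>) / (4 \<omega>) = 3 /
  (8 \<omega>), more than a quarter of the bound 1 / \<omega>.\<close>

lemma fd_trial_mirrored_sine:
  fixes n :: nat and s :: real
  assumes q: "q absolutely_integrable_on {0..1}" and s: "s \<in> {-1, 1}"
  defines "l0 \<equiv> 4 * pi^2 * (s * (2/3) + 2 * real n)^2"
  shows "fd_trial q (\<lambda>x. sin (sqrt l0 * x) / sqrt l0) (\<lambda>x. sin (sqrt l0 * (1 - x)) / sqrt l0)
    (\<lambda>x. cos (sqrt l0 * x)) (\<lambda>x. - cos (sqrt l0 * (1 - x))) (sqrt l0) (1 / sqrt l0)"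
proof -
  define \<omega> where "\<omega> = sqrt l0"
  \<comment> \<open>The absolute value is needed for s = -1, n = 0, where the factor is negative;
    the cosine does not see it.\<close>
  have \<omega>_eq: "\<omega> = 2 * \<bar>pi * (s * (2/3) + 2 * real n)\<bar>"
  proof -
    have "l0 = (2 * (pi * (s * (2/3) + 2 * real n)))\<^sup>2" by (simp add: l0_def power_mult_distrib)
    then show ?thesis unfolding \<omega>_def by (simp only: real_sqrt_abs abs_mult abs_numeral)
  qed
  have "s * (2/3) + 2 * real n \<noteq> 0"
  proof (cases n)
    case (Suc m)
    then show ?thesis using s by auto
  qed (use s in auto)
  then have \<omega>: "\<omega> > 0" by (simp add: \<omega>_eq)
  have half: "cos (\<omega> / 2) = - (1/2)"
  proof -
    have "cos (\<omega> / 2) = cos (pi * (s * (2/3) + 2 * real n))" by (simp add: \<omega>_eq cos_abs_real)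
    also have "\<dots> = cos (s * (2/3 * pi) + 2 * real n * pi)" by (simp add: algebra_simps)
    also have "\<dots> = cos (s * (2/3 * pi))" by (simp add: cos_add)
    also have "\<dots> = cos (2/3 * pi)" using s by auto
    also have "\<dots> = - (1/2)" using cos_120 by simp
    finally show ?thesis .
  qed
  have full: "cos \<omega> = - (1/2)"
    using cos_double_cos[of "\<omega> / 2"] half by (simp add: power2_eq_square)
  define c where "c = cos \<omega>"
  have I1: "integral {0..1/2} (\<lambda>t. sin (\<omega> * (1 - t)) * (sin (\<omega> * t) / \<omega>)) = (sin \<omega> / (2 * \<omega>) - c / 2) / (2 * \<omega>)"
  proof -
    have "integral {0..1/2} (\<lambda>t. sin (\<omega> * (1 - t)) * (sin (\<omega> * t) / \<omega>))
      = (\<lambda>t. (- sin (\<omega> * (1 - 2 * t)) / (2 * \<omega>) - t * c) / (2 * \<omega>)) (1/2)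
        - (\<lambda>t. (- sin (\<omega> * (1 - 2 * t)) / (2 * \<omega>) - t * c) / (2 * \<omega>)) 0"
    proof (rule integral_of_derivative)
      fix t :: real
      have "cos (\<omega> * (1 - 2 * t)) = cos (\<omega> * (1 - t) - \<omega> * t)" by (simp add: algebra_simps)
      then have 1: "cos (\<omega> * (1 - 2 * t)) = cos (\<omega> * (1 - t)) * cos (\<omega> * t) + sin (\<omega> * (1 - t)) * sin (\<omega> * t)"
        by (simp only: cos_diff)
      have "c = cos (\<omega> * (1 - t) + \<omega> * t)" by (simp add: c_def algebra_simps)
      then have 2: "c = cos (\<omega> * (1 - t)) * cos (\<omega> * t) - sin (\<omega> * (1 - t)) * sin (\<omega> * t)"
        by (simp only: cos_add)
      have 3: "sin (\<omega> * (1 - t)) * (sin (\<omega> * t) / \<omega>) = (cos (\<omega> * (1 - 2 * t)) - c) / (2 * \<omega>)"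
        using \<omega> unfolding 1 2 by (simp add: field_simps)
      show "((\<lambda>t. (- sin (\<omega> * (1 - 2 * t)) / (2 * \<omega>) - t * c) / (2 * \<omega>))
          has_real_derivative sin (\<omega> * (1 - t)) * (sin (\<omega> * t) / \<omega>)) (at t)"
        unfolding 3 using \<omega> by (auto intro!: derivative_eq_intros simp: field_simps)
    qed simp
    then show ?thesis using \<omega> by (simp add: field_simps)
  qed
  have I2: "integral {1/2..1} (\<lambda>t. sin (\<omega> * (1 - t)) * (sin (\<omega> * (1 - t)) / \<omega>)) = (1/2 - sin \<omega> / (2 * \<omega>)) / (2 * \<omega>)"
  proof -
    have "integral {1/2..1} (\<lambda>t. sin (\<omega> * (1 - t)) * (sin (\<omega> * (1 - t)) / \<omega>))
      = (\<lambda>t. (t + sin (2 * (\<omega> * (1 - t))) / (2 * \<omega>)) / (2 * \<omega>)) 1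
        - (\<lambda>t. (t + sin (2 * (\<omega> * (1 - t))) / (2 * \<omega>)) / (2 * \<omega>)) (1/2)"
    proof (rule integral_of_derivative)
      fix t :: real
      have 3: "sin (\<omega> * (1 - t)) * (sin (\<omega> * (1 - t)) / \<omega>) = (1 - cos (2 * (\<omega> * (1 - t)))) / (2 * \<omega>)"
        unfolding cos_double_sin using \<omega> by (simp add: power2_eq_square)
      show "((\<lambda>t. (t + sin (2 * (\<omega> * (1 - t))) / (2 * \<omega>)) / (2 * \<omega>))
          has_real_derivative sin (\<omega> * (1 - t)) * (sin (\<omega> * (1 - t)) / \<omega>)) (at t)"
        unfolding 3 using \<omega> by (auto intro!: derivative_eq_intros simp: field_simps)
    qed simp
    then show ?thesis using \<omega> by (simp add: field_simps)
  qed
  have I: "integral {0..1/2} (\<lambda>t. sin (\<omega> * (1 - t)) * (sin (\<omega> * t) / \<omega>))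
     + integral {1/2..1} (\<lambda>t. sin (\<omega> * (1 - t)) * (sin (\<omega> * (1 - t)) / \<omega>)) = 3 / (8 * \<omega>)"
    unfolding I1 I2 c_def full using \<omega> by (simp add: field_simps)
  show ?thesis
    unfolding \<omega>_def[symmetric]
  proof
    show "q absolutely_integrable_on {0..1}" by (rule q)
    show "sol2 0 (1/2) (\<lambda>x. sin (\<omega> * x) / \<omega>) (\<lambda>x. cos (\<omega> * x)) (\<lambda>x. - (\<omega>\<^sup>2 * (sin (\<omega> * x) / \<omega>)))"
      by (rule sol2_of_derivatives) (use \<omega> in \<open>auto intro!: derivative_eq_intros simp: power2_eq_square\<close>)
    show "sol2 (1/2) 1 (\<lambda>x. sin (\<omega> * (1 - x)) / \<omega>) (\<lambda>x. - cos (\<omega> * (1 - x)))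
        (\<lambda>x. - (\<omega>\<^sup>2 * (sin (\<omega> * (1 - x)) / \<omega>)))"
      by (rule sol2_of_derivatives) (use \<omega> in \<open>auto intro!: derivative_eq_intros simp: power2_eq_square\<close>)
    show "- cos (\<omega> * (1 - 1/2)) - cos (\<omega> * (1/2)) = 1" using half by simp
    show "1 / \<omega> \<le> 4 * \<bar>integral {0..1/2} (\<lambda>t. sin (\<omega> * (1 - t)) * (sin (\<omega> * t) / \<omega>))
      + integral {1/2..1} (\<lambda>t. sin (\<omega> * (1 - t)) * (sin (\<omega> * (1 - t)) / \<omega>))\<bar>"
      unfolding I using \<omega> by (simp add: field_simps)
    show "\<bar>sin (\<omega> * x) / \<omega>\<bar> \<le> 1 / \<omega>" "\<bar>sin (\<omega> * (1 - x)) / \<omega>\<bar> \<le> 1 / \<omega>" for x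
      using \<omega> by (auto simp: abs_divide intro!: divide_right_mono)
  qed (use \<omega> in auto)
qed

text \<open>With amplitude e = 1 + (-1)^n on the right half, the sum of the two integrals is -(1 +
  e) / (4 \<omega>). The bound (1 + e) / \<omega> is exactly four times its modulus for both
  parities; this family dictates the constant 4.\<close>

lemma fd_trial_periodic_sine:
  fixes n :: nat
  assumes q: "q absolutely_integrable_on {0..1}" and n: "n \<ge> 1"
  shows "fd_trial q (\<lambda>x. sin (2 * pi * real n * x) / (2 * pi * real n))
    (\<lambda>x. ((-1)^n + 1) / (2 * pi * real n) * sin (2 * pi * real n * x))
    (\<lambda>x. cos (2 * pi * real n * x)) (\<lambda>x. ((-1)^n + 1) * cos (2 * pi * real n * x))
    (2 * pi * real n) ((2 + (-1)^n) / (2 * pi * real n))"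
proof -
  define \<omega> where "\<omega> = 2 * pi * real n"
  define e :: real where "e = (-1)^n + 1"
  have \<omega>: "\<omega> > 0" using n by (simp add: \<omega>_def)
  \<comment> \<open>e is 0 or 2. Since cos (\<omega> / 2) = e - 1, the second identity turns the
    derivative jump e (e - 1) - (e - 1) into 1.\<close>
  have e: "0 \<le> e" "e * (e - 1) = e" by (cases "even n"; simp add: e_def)+
  have half: "cos (\<omega> * (1/2)) = e - 1" "sin (\<omega> * (1/2)) = 0"
    using cos_npi[of n] sin_npi[of n] by (simp_all add: \<omega>_def e_def mult.commute)
  have full: "cos \<omega> = 1" "sin \<omega> = 0"
    using cos_2npi[of n] sin_2npi[of n] by (simp_all add: \<omega>_def mult_ac)
  have sin1: "sin (\<omega> * (1 - t)) = - sin (\<omega> * t)" for t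
    using full by (simp add: right_diff_distrib sin_diff)
  have der: "((\<lambda>t. k * (sin (2 * (\<omega> * t)) / (2 * \<omega>) - t) / (2 * \<omega>))
      has_real_derivative - sin (\<omega> * t) * (k / \<omega> * sin (\<omega> * t))) (at t)" for k t
  proof -
    have 3: "- sin (\<omega> * t) * (k / \<omega> * sin (\<omega> * t)) = k * (cos (2 * (\<omega> * t)) - 1) / (2 * \<omega>)"
      unfolding cos_double_sin using \<omega> by (simp add: power2_eq_square field_simps)
    show ?thesis unfolding 3 using \<omega> by (auto intro!: derivative_eq_intros)
  qed
  have sin2: "sin (2 * \<omega>) = 0" using full by (simp add: sin_double)
  have I1: "integral {0..1/2} (\<lambda>t. sin (\<omega> * (1 - t)) * (sin (\<omega> * t) / \<omega>)) = - 1 / (4 * \<omega>)"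
    using integral_of_derivative[OF der[of 1], of 0 "1/2"] full by (simp add: sin1)
  have I2: "integral {1/2..1} (\<lambda>t. sin (\<omega> * (1 - t)) * (e / \<omega> * sin (\<omega> * t))) = - e / (4 * \<omega>)"
    unfolding sin1 by (subst integral_of_derivative[OF der]) (use full sin2 \<omega> in \<open>simp_all add: field_simps\<close>)
  have I: "1 + e \<le> \<omega> * (4 * \<bar>integral {0..1/2} (\<lambda>t. sin (\<omega> * (1 - t)) * (sin (\<omega> * t) / \<omega>))
     + integral {1/2..1} (\<lambda>t. sin (\<omega> * (1 - t)) * (e / \<omega> * sin (\<omega> * t)))\<bar>)"
  proof -
    have "- 1 / (4 * \<omega>) + - e / (4 * \<omega>) = - ((1 + e) / (4 * \<omega>))" using \<omega> by (simp add: field_simps)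
    then show ?thesis unfolding I1 I2 using \<omega> e(1) by (simp only: abs_minus) simp
  qed
  have "fd_trial q (\<lambda>x. sin (\<omega> * x) / \<omega>) (\<lambda>x. e / \<omega> * sin (\<omega> * x))
    (\<lambda>x. cos (\<omega> * x)) (\<lambda>x. e * cos (\<omega> * x)) \<omega> ((1 + e) / \<omega>)"
  proof
    show "q absolutely_integrable_on {0..1}" by (rule q)
    show "sol2 0 (1/2) (\<lambda>x. sin (\<omega> * x) / \<omega>) (\<lambda>x. cos (\<omega> * x)) (\<lambda>x. - (\<omega>\<^sup>2 * (sin (\<omega> * x) / \<omega>)))"
      by (rule sol2_of_derivatives) (use \<omega> in \<open>auto intro!: derivative_eq_intros simp: power2_eq_square\<close>)
    show "sol2 (1/2) 1 (\<lambda>x. e / \<omega> * sin (\<omega> * x)) (\<lambda>x. e * cos (\<omega> * x))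
        (\<lambda>x. - (\<omega>\<^sup>2 * (e / \<omega> * sin (\<omega> * x))))"
      by (rule sol2_of_derivatives) (use \<omega> in \<open>auto intro!: derivative_eq_intros simp: power2_eq_square\<close>)
    show "e * cos (\<omega> * (1/2)) - cos (\<omega> * (1/2)) = 1"
      unfolding half(1) using e(2) by linarith
    show "(1 + e) / \<omega> \<le> 4 * \<bar>integral {0..1/2} (\<lambda>t. sin (\<omega> * (1 - t)) * (sin (\<omega> * t) / \<omega>))
      + integral {1/2..1} (\<lambda>t. sin (\<omega> * (1 - t)) * (e / \<omega> * sin (\<omega> * t)))\<bar>"
      using I \<omega> by (simp add: divide_le_eq mult.commute)
    show "sin (\<omega> * (1/2)) / \<omega> = e / \<omega> * sin (\<omega> * (1/2))" unfolding half by simp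
    show "\<bar>sin (\<omega> * x) / \<omega>\<bar> \<le> (1 + e) / \<omega>" for x
    proof -
      have "\<bar>sin (\<omega> * x)\<bar> \<le> 1 + e" using abs_sin_le_one[of "\<omega> * x"] e(1) by linarith
      then show ?thesis using \<omega> by (simp add: abs_divide divide_right_mono)
    qed
    show "\<bar>e / \<omega> * sin (\<omega> * x)\<bar> \<le> (1 + e) / \<omega>" for x
    proof -
      have "e * \<bar>sin (\<omega> * x)\<bar> \<le> e * 1" by (rule mult_left_mono) (use e in auto)
      then have "e * \<bar>sin (\<omega> * x)\<bar> \<le> 1 + e" by linarith
      then show ?thesis using \<omega> e(1) by (simp add: abs_mult abs_divide divide_right_mono)
    qed
  qed (use \<omega> e full in auto)
  moreover have "1 + e = 2 + (-1) ^ n" by (simp add: e_def)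
  ultimately show ?thesis unfolding \<omega>_def e_def by simp
qed

theorem theorem1:
  fixes q :: "real \<Rightarrow> real"
  assumes q: "q absolutely_integrable_on {0..1}"
  shows
  "(\<forall>(n::nat) (s::real). s \<in> {-1, 1} \<longrightarrow>
     (let l0 = 4 * pi^2 * (s * (2/3) + 2 * real n)^2;
          R = Rconst q;
          r = (2 + sqrt 3) * ((11/3) * L1norm q * (1 + 16/3 + 2 * sqrt (88/9))) / (sqrt 3 * sqrt l0)
      in r < 1 \<longrightarrow>
        (\<exists>lam U1 U2. fd_seq q l0 (\<lambda>x. sin (sqrt l0 * x) / sqrt l0)
                                   (\<lambda>x. sin (sqrt l0 * (1 - x)) / sqrt l0) lam U1 U2) \<and>
        (\<forall>lam U1 U2. fd_seq q l0 (\<lambda>x. sin (sqrt l0 * x) / sqrt l0)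
                                   (\<lambda>x. sin (sqrt l0 * (1 - x)) / sqrt l0) lam U1 U2 \<longrightarrow>
          (\<exists>Lam u1 u2.
             lam sums Lam \<and>
             (\<forall>x\<in>{0..1/2}. (\<lambda>j. U1 j x) sums u1 x) \<and>
             (\<forall>x\<in>{1/2..1}. (\<lambda>j. U2 j x) sums u2 x) \<and>
             eig_sol q Lam u1 u2 \<and>
             (\<exists>c>0. \<exists>\<epsilon>>0. \<forall>m::nat. let C = c / (1 - r) in
                (\<forall>x\<in>{0..1/2}. \<bar>u1 x - (\<Sum>j\<le>m. U1 j x)\<bar>
                    \<le> 3 * C / (8 * real (m+1) powr (1+\<epsilon>) * sqrt l0) * r^(m+1)) \<and>
                (\<forall>x\<in>{1/2..1}. \<bar>u2 x - (\<Sum>j\<le>m. U2 j x)\<bar>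
                    \<le> 3 * C / (8 * real (m+1) powr (1+\<epsilon>) * sqrt l0) * r^(m+1)) \<and>
                \<bar>Lam - (\<Sum>j\<le>m. lam j)\<bar> \<le> C / (real (m+1) powr (1+\<epsilon>) * R) * r^m)))))
   \<and>
   (\<forall>n::nat. n \<ge> 1 \<longrightarrow>
     (let l0 = 4 * pi^2 * (real n)^2;
          R = Rconst q;
          r = 1 / (pi * real n * R);
          u01 = (\<lambda>x. sin (2 * pi * real n * x) / (2 * pi * real n));
          u02 = (\<lambda>x. ((-1)^n + 1) / (2 * pi * real n) * sin (2 * pi * real n * x));
          K = (if even n then 3 else 1)
      in r < 1 \<longrightarrow>
        (\<exists>lam U1 U2. fd_seq q l0 u01 u02 lam U1 U2) \<and>
        (\<forall>lam U1 U2. fd_seq q l0 u01 u02 lam U1 U2 \<longrightarrow>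
          (\<exists>Lam u1 u2.
             lam sums Lam \<and>
             (\<forall>x\<in>{0..1/2}. (\<lambda>j. U1 j x) sums u1 x) \<and>
             (\<forall>x\<in>{1/2..1}. (\<lambda>j. U2 j x) sums u2 x) \<and>
             eig_sol q Lam u1 u2 \<and>
             (\<exists>c>0. \<exists>\<epsilon>>0. \<forall>m::nat. let C = c / (1 - r) in
                \<bar>Lam - (\<Sum>j\<le>m. lam j)\<bar> \<le> C / (real (m+1) powr (1+\<epsilon>) * R) * r^m \<and>
                (\<forall>x\<in>{0..1/2}. \<bar>u1 x - (\<Sum>j\<le>m. U1 j x)\<bar>
                    \<le> K * C / (8 * pi * real n * real (m+1) powr (1+\<epsilon>)) * r^(m+1)) \<and>
                (\<forall>x\<in>{1/2..1}. \<bar>u2 x - (\<Sum>j\<le>m. U2 j x)\<bar>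
                    \<le> K * C / (8 * pi * real n * real (m+1) powr (1+\<epsilon>)) * r^(m+1)))))))"
proof (intro conjI allI impI)
  fix n :: nat and s :: real
  assume s: "s \<in> {-1, 1}"
  define l0 where "l0 = 4 * pi^2 * (s * (2/3) + 2 * real n)^2"
  interpret t: fd_trial q "\<lambda>x. sin (sqrt l0 * x) / sqrt l0" "\<lambda>x. sin (sqrt l0 * (1 - x)) / sqrt l0"
    "\<lambda>x. cos (sqrt l0 * x)" "\<lambda>x. - cos (sqrt l0 * (1 - x))" "sqrt l0" "1 / sqrt l0"
    unfolding l0_def by (rule fd_trial_mirrored_sine[OF q s])
  have sq: "(sqrt l0)\<^sup>2 = l0" by (rule real_sqrt_pow2) (simp add: l0_def)
  define r where "r = (2 + sqrt 3) * ((11/3) * L1norm q * (1 + 16/3 + 2 * sqrt (88/9))) / (sqrt 3 * sqrt l0)"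
  \<comment> \<open>Here (2 + sqrt 3) / sqrt 3 exceeds 2, so the rate has room to spare.\<close>
  have r_ge: "2 * ((11/3) * L1norm q * (1 + 16/3 + 2 * sqrt (88/9))) / sqrt l0 \<le> r"
  proof -
    define X where "X = (11/3) * L1norm q * (1 + 16/3 + 2 * sqrt (88/9))"
    have X: "0 \<le> X / sqrt l0" using t.L1norm_nonneg t.\<omega> by (simp add: X_def)
    have "sqrt 3 \<le> sqrt (2\<^sup>2)" by (subst real_sqrt_le_iff) simp
    then have "2 \<le> (2 + sqrt 3) / sqrt 3" by (simp add: field_simps)
    then have "2 * (X / sqrt l0) \<le> (2 + sqrt 3) / sqrt 3 * (X / sqrt l0)" using X by (rule mult_right_mono)
    then show ?thesis unfolding r_def X_def[symmetric] by simp
  qed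
  have r_0: "r = 0" if "L1norm q = 0" using that by (simp add: r_def)
  have "3 / (8 * sqrt l0) > 0" using t.\<omega> by simp
  note bounds = t.fd_seq_error_bounds[unfolded sq, OF _ r_ge _ r_0 this]
  show "let l0 = 4 * pi^2 * (s * (2/3) + 2 * real n)^2;
          R = Rconst q;
          r = (2 + sqrt 3) * ((11/3) * L1norm q * (1 + 16/3 + 2 * sqrt (88/9))) / (sqrt 3 * sqrt l0)
      in r < 1 \<longrightarrow>
        (\<exists>lam U1 U2. fd_seq q l0 (\<lambda>x. sin (sqrt l0 * x) / sqrt l0)
                                   (\<lambda>x. sin (sqrt l0 * (1 - x)) / sqrt l0) lam U1 U2) \<and>
        (\<forall>lam U1 U2. fd_seq q l0 (\<lambda>x. sin (sqrt l0 * x) / sqrt l0)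
                                   (\<lambda>x. sin (sqrt l0 * (1 - x)) / sqrt l0) lam U1 U2 \<longrightarrow>
          (\<exists>Lam u1 u2.
             lam sums Lam \<and>
             (\<forall>x\<in>{0..1/2}. (\<lambda>j. U1 j x) sums u1 x) \<and>
             (\<forall>x\<in>{1/2..1}. (\<lambda>j. U2 j x) sums u2 x) \<and>
             eig_sol q Lam u1 u2 \<and>
             (\<exists>c>0. \<exists>\<epsilon>>0. \<forall>m::nat. let C = c / (1 - r) in
                (\<forall>x\<in>{0..1/2}. \<bar>u1 x - (\<Sum>j\<le>m. U1 j x)\<bar>
                    \<le> 3 * C / (8 * real (m+1) powr (1+\<epsilon>) * sqrt l0) * r^(m+1)) \<and>
                (\<forall>x\<in>{1/2..1}. \<bar>u2 x - (\<Sum>j\<le>m. U2 j x)\<bar>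
                    \<le> 3 * C / (8 * real (m+1) powr (1+\<epsilon>) * sqrt l0) * r^(m+1)) \<and>
                \<bar>Lam - (\<Sum>j\<le>m. lam j)\<bar> \<le> C / (real (m+1) powr (1+\<epsilon>) * R) * r^m)))"
    unfolding Let_def l0_def[symmetric] r_def[symmetric]
  proof (intro impI conjI allI)
    show "\<exists>lam U1 U2. fd_seq q l0 (\<lambda>x. sin (sqrt l0 * x) / sqrt l0)
        (\<lambda>x. sin (sqrt l0 * (1 - x)) / sqrt l0) lam U1 U2"
      using t.fd_seq_exists unfolding sq .
    fix lam U1 U2
    assume r1: "r < 1" and fd: "fd_seq q l0 (\<lambda>x. sin (sqrt l0 * x) / sqrt l0)
        (\<lambda>x. sin (sqrt l0 * (1 - x)) / sqrt l0) lam U1 U2"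
    have E: "3 * C / (8 * P * sqrt l0) = 3 / (8 * sqrt l0) * C / P" for C P :: real
      by simp
    show "\<exists>Lam u1 u2.
             lam sums Lam \<and>
             (\<forall>x\<in>{0..1/2}. (\<lambda>j. U1 j x) sums u1 x) \<and>
             (\<forall>x\<in>{1/2..1}. (\<lambda>j. U2 j x) sums u2 x) \<and>
             eig_sol q Lam u1 u2 \<and>
             (\<exists>c>0. \<exists>\<epsilon>>0. \<forall>m::nat.
                (\<forall>x\<in>{0..1/2}. \<bar>u1 x - (\<Sum>j\<le>m. U1 j x)\<bar>
                    \<le> 3 * (c / (1 - r)) / (8 * real (m+1) powr (1+\<epsilon>) * sqrt l0) * r^(m+1)) \<and>
                (\<forall>x\<in>{1/2..1}. \<bar>u2 x - (\<Sum>j\<le>m. U2 j x)\<bar>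
                    \<le> 3 * (c / (1 - r)) / (8 * real (m+1) powr (1+\<epsilon>) * sqrt l0) * r^(m+1)) \<and>
                \<bar>Lam - (\<Sum>j\<le>m. lam j)\<bar> \<le> (c / (1 - r)) / (real (m+1) powr (1+\<epsilon>) * Rconst q) * r^m)"
      unfolding E using bounds[OF fd r1] by blast
  qed
next
  fix n :: nat
  assume n: "n \<ge> 1"
  define u01 where "u01 = (\<lambda>x. sin (2 * pi * real n * x) / (2 * pi * real n))"
  define u02 where "u02 = (\<lambda>x. ((-1)^n + 1) / (2 * pi * real n) * sin (2 * pi * real n * x))"
  define K :: real where "K = (if even n then 3 else 1)"
  define l0 where "l0 = 4 * pi^2 * (real n)^2"
  define r where "r = 1 / (pi * real n * Rconst q)"
  interpret t: fd_trial q u01 u02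
    "\<lambda>x. cos (2 * pi * real n * x)" "\<lambda>x. ((-1)^n + 1) * cos (2 * pi * real n * x)"
    "2 * pi * real n" "(2 + (-1)^n) / (2 * pi * real n)"
    unfolding u01_def u02_def by (rule fd_trial_periodic_sine[OF q n])
  have sq: "(2 * pi * real n)\<^sup>2 = l0" by (simp add: l0_def power_mult_distrib)
  \<comment> \<open>An equality in this family: the frequency 2 \<pi> n cancels the factor
    2.\<close>
  have r_ge: "2 * ((11/3) * L1norm q * (1 + 16/3 + 2 * sqrt (88/9))) / (2 * pi * real n) \<le> r"
  proof -
    define X where "X = (11/3) * L1norm q * (1 + 16/3 + 2 * sqrt (88/9))"
    have "Rconst q = 1 / X" by (simp only: Rconst_def X_def)
    then show ?thesis unfolding r_def X_def[symmetric] by simp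
  qed
  have r_0: "r = 0" if "L1norm q = 0" using that by (simp add: r_def Rconst_def)
  have "K / (8 * pi * real n) > 0" using n by (simp add: K_def)
  note bounds = t.fd_seq_error_bounds[unfolded sq, OF _ r_ge _ r_0 this]
  show "let l0 = 4 * pi^2 * (real n)^2;
          R = Rconst q;
          r = 1 / (pi * real n * R);
          u01 = (\<lambda>x. sin (2 * pi * real n * x) / (2 * pi * real n));
          u02 = (\<lambda>x. ((-1)^n + 1) / (2 * pi * real n) * sin (2 * pi * real n * x));
          K = (if even n then 3 else 1)
      in r < 1 \<longrightarrow>
        (\<exists>lam U1 U2. fd_seq q l0 u01 u02 lam U1 U2) \<and>
        (\<forall>lam U1 U2. fd_seq q l0 u01 u02 lam U1 U2 \<longrightarrow>
          (\<exists>Lam u1 u2.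
             lam sums Lam \<and>
             (\<forall>x\<in>{0..1/2}. (\<lambda>j. U1 j x) sums u1 x) \<and>
             (\<forall>x\<in>{1/2..1}. (\<lambda>j. U2 j x) sums u2 x) \<and>
             eig_sol q Lam u1 u2 \<and>
             (\<exists>c>0. \<exists>\<epsilon>>0. \<forall>m::nat. let C = c / (1 - r) in
                \<bar>Lam - (\<Sum>j\<le>m. lam j)\<bar> \<le> C / (real (m+1) powr (1+\<epsilon>) * R) * r^m \<and>
                (\<forall>x\<in>{0..1/2}. \<bar>u1 x - (\<Sum>j\<le>m. U1 j x)\<bar>
                    \<le> K * C / (8 * pi * real n * real (m+1) powr (1+\<epsilon>)) * r^(m+1)) \<and>
                (\<forall>x\<in>{1/2..1}. \<bar>u2 x - (\<Sum>j\<le>m. U2 j x)\<bar>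
                    \<le> K * C / (8 * pi * real n * real (m+1) powr (1+\<epsilon>)) * r^(m+1)))))"
    unfolding Let_def l0_def[symmetric] r_def[symmetric] u01_def[symmetric] u02_def[symmetric] K_def[symmetric]
  proof (intro impI conjI allI)
    show "\<exists>lam U1 U2. fd_seq q l0 u01 u02 lam U1 U2"
      using t.fd_seq_exists unfolding sq .
    fix lam U1 U2
    assume r1: "r < 1" and fd: "fd_seq q l0 u01 u02 lam U1 U2"
    have E: "K * C / (8 * pi * real n * P) = K / (8 * pi * real n) * C / P" for C P :: real
      by simp
    show "\<exists>Lam u1 u2.
             lam sums Lam \<and>
             (\<forall>x\<in>{0..1/2}. (\<lambda>j. U1 j x) sums u1 x) \<and>
             (\<forall>x\<in>{1/2..1}. (\<lambda>j. U2 j x) sums u2 x) \<and>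
             eig_sol q Lam u1 u2 \<and>
             (\<exists>c>0. \<exists>\<epsilon>>0. \<forall>m::nat.
                \<bar>Lam - (\<Sum>j\<le>m. lam j)\<bar> \<le> (c / (1 - r)) / (real (m+1) powr (1+\<epsilon>) * Rconst q) * r^m \<and>
                (\<forall>x\<in>{0..1/2}. \<bar>u1 x - (\<Sum>j\<le>m. U1 j x)\<bar>
                    \<le> K * (c / (1 - r)) / (8 * pi * real n * real (m+1) powr (1+\<epsilon>)) * r^(m+1)) \<and>
                (\<forall>x\<in>{1/2..1}. \<bar>u2 x - (\<Sum>j\<le>m. U2 j x)\<bar>
                    \<le> K * (c / (1 - r)) / (8 * pi * real n * real (m+1) powr (1+\<epsilon>)) * r^(m+1)))"
      unfolding E using bounds[OF fd r1] by blast
  qed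
qed

end
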